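(* Given as input the boundary matrix $\Delta$ of a filtered Lefschetz complex $(X,f)$, with rows and columns ordered by $f$, the algorithm DEPTH-POSET (described in the context) computes the depth poset $\mathcal{D}_f$ of $f$; that is, its output equals $\mathcal{D}_f$.
   Context: Fix a field $\mathbb{F}$. A Lefschetz complex is a triple $(X,\dim,\kappa)$ with $X$ a finite set (of cells), $\dim\colon X\to\mathbb{Z}$, and an incidence map $\kappa\colon X\times X\to\mathbb{F}$ such that $\sum_{y\in X}\kappa(z,y)\kappa(y,x)=0$ for all $z,x\in X$, and $\kappa(y,x)\neq 0$ only if $\dim y=\dim x+1$. If $\kappa(y,x)\ne 0$, then $x$ is a facet of $y$ and $y$ is a cofacet of $x$. A filter on $X$ is an injective map $f\colon X\to\mathbb{R}$ with $f(x)<f(y)$ whenever $x$ is a facet of $y$; $(X,f)$ is then a filtered Lefschetz complex. The boundary matrix $\Delta$ has rows and columns indexed by $X$, ordered by $f$, with $\Delta[x,y]=\kappa(y,x)$. Birth-death pairs: a reduced form of $\Delta$ is a matrix $R=\Delta\cdot V$ with $V-\mathrm{Id}$ strictly upper triangular and such that the pivots (lowest non-zero entries) of the non-zero columns of $R$ lie in pairwise different rows. $\mathrm{BD}(f)$ is the set of pairs $(s,t)\in X\times X$ such that column $t$ of $R$ is non-zero and its pivot is in row $s$; this does not depend on the choice of $R$. Shallow pairs: $\mathrm{SH}(f)$ is the set of pairs $(s,t)$ such that $s$ is a facet of $t$, $f(x)\le f(s)$ for all facets $x$ of $t$, and $f(y)\ge f(t)$ for all cofacets $y$ of $s$. One has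 $\mathrm{SH}(f)\subseteq\mathrm{BD}(f)$. Cancellation: if $s$ is a facet of $t$, the quotient of $X$ by $(s,t)$ is the Lefschetz complex with cells $X\setminus\{s,t\}$, restricted dimension map, and incidence map $\kappa'(y,x)=\kappa(y,x)-\kappa(t,s)^{-1}\kappa(y,s)\kappa(t,x)$. If $(s,t)\in\mathrm{SH}(f)$, the restriction of $f$ is a filter on the quotient. Shallow orders: let $n=\#\mathrm{BD}(f)$. A shallow order of $f$ is an enumeration $\Phi=(\varphi_1,\dots,\varphi_n)$ of $\mathrm{BD}(f)$ such that, setting $X_0=X$, $f_0=f$, and letting $X_i$ be the quotient of $X_{i-1}$ by $\varphi_i$ and $f_i=f|_{X_i}$, one has $\varphi_i\in\mathrm{SH}(f_{i-1})$ for $i=1,\dots,n$. It is identified with the linear order $\varphi_i\le_\Phi\varphi_j\iff i\le j$. The depth poset $\mathcal{D}_f$ is the partial order on $\mathrm{BD}(f)$ that is the intersection (as relations) of all shallow orders of $f$. Algorithm DEATH. Start with $A=\Delta$, $D=\emptyset$, $L=\emptyset$. While $A\ne0$: let $s$ be the last (lowest) index of a non-zero row of $A$, and $t$ the first index with $A[s,t]\ne0$; append $(s,t)$ to $D$; for every $y>t$ with $A[s,y]\neq0$ replace column $A[\cdot,y]$ by $A[\cdot,y]-A[s,t]^{-1}A[s,y]\,A[\cdot,t]$ and append $(t,y)$ to $L$; then delete rows $s,t$ and columns $s,t$ from $A$. Finally return $R^\times=\{((s,t),(s',t'))\in D\times D\mid (t,t')\in L\}$. Algorithm BIRTH. Start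 with $A=\Delta$, $D=\emptyset$, $L=\emptyset$. While $A\neq0$: let $t$ be the first index of a non-zero column of $A$, and $s$ the last index with $A[s,t]\neq0$; append $(s,t)$ to $D$; for every $x<s$ with $A[x,t]\ne0$ replace row $A[x,\cdot]$ by $A[x,\cdot]-A[s,t]^{-1}A[x,t]\,A[s,\cdot]$ and append $(s,x)$ to $L$; then delete rows $s,t$ and columns $s,t$ from $A$. Finally return $R^\circ=\{((s,t),(s',t'))\in D\times D\mid (s,s')\in L\}$. Algorithm DEPTH-POSET. Compute $R^\times$ with DEATH and $R^\circ$ with BIRTH, both applied to $\Delta$, and output the transitive closure of $R^\times\cup R^\circ$. Convention: the transitive closure of a relation on a set $P$ (here $P=\mathrm{BD}(f)$) consists of all $(p,q)$ for which there is a sequence $p=r_0,r_1,\dots,r_m=q$, $m\ge0$, with consecutive elements related; $m=0$ is allowed, so the closure is reflexive. *)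

theory Defs
  imports Complex_Main "HOL-Library.While_Combinator"
begin

section \<open>Filtered Lefschetz complexes\<close>

text \<open>
  Values of \<open>cdim\<close> and \<open>inc\<close> at arguments outside \<open>cells\<close> are irrelevant.
  The incidence coefficient \<open>\<kappa>(y,x)\<close> is \<open>inc K y x\<close>, with the cofacet as first argument.
\<close>

record ('a, 'k) lefschetz =
  cells :: "'a set"
  cdim :: "'a \<Rightarrow> int"
  inc :: "'a \<Rightarrow> 'a \<Rightarrow> 'k"

definition lefschetz_complex :: "('a, 'k::field) lefschetz \<Rightarrow> bool" where
  "lefschetz_complex K \<longleftrightarrow>
     finite (cells K) \<and>
     (\<forall>z\<in>cells K. \<forall>x\<in>cells K. (\<Sum>y\<in>cells K. inc K z y * inc K y x) = 0) \<and>
     (\<forall>y\<in>cells K. \<forall>x\<in>cells K. inc K y x \<noteq> 0 \<longrightarrow> cdim K y = cdim K x + 1)"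

definition facet :: "('a, 'k::field) lefschetz \<Rightarrow> 'a \<Rightarrow> 'a \<Rightarrow> bool" where
  "facet K x y \<longleftrightarrow> x \<in> cells K \<and> y \<in> cells K \<and> inc K y x \<noteq> 0"

definition filter_on :: "('a, 'k::field) lefschetz \<Rightarrow> ('a \<Rightarrow> real) \<Rightarrow> bool" where
  "filter_on K f \<longleftrightarrow> inj_on f (cells K) \<and> (\<forall>x y. facet K x y \<longrightarrow> f x < f y)"

text \<open>
  A square matrix is a function of a row and a column index together with a finite index set \<open>I\<close>,
  which is ordered by an injective function \<open>f\<close>.
\<close>

definition boundary_matrix :: "('a, 'k::field) lefschetz \<Rightarrow> 'a \<Rightarrow> 'a \<Rightarrow> 'k" where
  "boundary_matrix K x y = inc K y x"

section \<open>Birth-death pairs\<close>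

definition mat_mult :: "'a set \<Rightarrow> ('a \<Rightarrow> 'a \<Rightarrow> 'k::field) \<Rightarrow> ('a \<Rightarrow> 'a \<Rightarrow> 'k) \<Rightarrow> 'a \<Rightarrow> 'a \<Rightarrow> 'k" where
  "mat_mult I A B x y = (\<Sum>z\<in>I. A x z * B z y)"

definition unit_upper_triangular :: "'a set \<Rightarrow> ('a \<Rightarrow> real) \<Rightarrow> ('a \<Rightarrow> 'a \<Rightarrow> 'k::field) \<Rightarrow> bool" where
  "unit_upper_triangular I f V \<longleftrightarrow>
     (\<forall>x\<in>I. V x x = 1) \<and> (\<forall>x\<in>I. \<forall>y\<in>I. f y < f x \<longrightarrow> V x y = 0)"

text \<open>Column \<open>t\<close> of \<open>R\<close> is non-zero and its lowest non-zero entry is in row \<open>s\<close>.\<close>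

definition pivot :: "'a set \<Rightarrow> ('a \<Rightarrow> real) \<Rightarrow> ('a \<Rightarrow> 'a \<Rightarrow> 'k::field) \<Rightarrow> 'a \<Rightarrow> 'a \<Rightarrow> bool" where
  "pivot I f R s t \<longleftrightarrow>
     s \<in> I \<and> t \<in> I \<and> R s t \<noteq> 0 \<and> (\<forall>x\<in>I. R x t \<noteq> 0 \<longrightarrow> f x \<le> f s)"

definition reduced_form ::
  "'a set \<Rightarrow> ('a \<Rightarrow> real) \<Rightarrow> ('a \<Rightarrow> 'a \<Rightarrow> 'k::field) \<Rightarrow> ('a \<Rightarrow> 'a \<Rightarrow> 'k) \<Rightarrow> bool" where
  "reduced_form I f A R \<longleftrightarrow>
     (\<exists>V. unit_upper_triangular I f V \<and> R = mat_mult I A V) \<and>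
     (\<forall>s t t'. pivot I f R s t \<and> pivot I f R s t' \<longrightarrow> t = t')"

text \<open>The choice of the reduced form is immaterial: all of them have the same pivot positions.\<close>

definition BD :: "('a, 'k::field) lefschetz \<Rightarrow> ('a \<Rightarrow> real) \<Rightarrow> ('a \<times> 'a) set" where
  "BD K f = {(s, t). \<exists>R. reduced_form (cells K) f (boundary_matrix K) R \<and> pivot (cells K) f R s t}"

section \<open>Shallow pairs, cancellation and the depth poset\<close>

definition SH :: "('a, 'k::field) lefschetz \<Rightarrow> ('a \<Rightarrow> real) \<Rightarrow> ('a \<times> 'a) set" where
  "SH K f = {(s, t). facet K s t \<and> (\<forall>x. facet K x t \<longrightarrow> f x \<le> f s) \<and>
                     (\<forall>y. facet K s y \<longrightarrow> f t \<le> f y)}"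

definition quotient :: "('a, 'k::field) lefschetz \<Rightarrow> 'a \<times> 'a \<Rightarrow> ('a, 'k) lefschetz" where
  "quotient K = (\<lambda>(s, t).
     K\<lparr>cells := cells K - {s, t},
       inc := (\<lambda>y x. inc K y x - inverse (inc K t s) * inc K y s * inc K t x)\<rparr>)"

text \<open>
  With 0-based indexing, \<open>foldl quotient K (take i \<Phi>)\<close> is the complex left after cancelling
  the first \<open>i\<close> pairs of \<open>\<Phi>\<close>.
\<close>

definition shallow_order ::
  "('a, 'k::field) lefschetz \<Rightarrow> ('a \<Rightarrow> real) \<Rightarrow> ('a \<times> 'a) list \<Rightarrow> bool" where
  "shallow_order K f \<Phi> \<longleftrightarrow>
     distinct \<Phi> \<and> set \<Phi> = BD K f \<and>
     (\<forall>i<length \<Phi>. \<Phi> ! i \<in> SH (foldl quotient K (take i \<Phi>)) f)"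

definition list_order :: "'b list \<Rightarrow> ('b \<times> 'b) set" where
  "list_order \<Phi> = {(\<Phi> ! i, \<Phi> ! j) | i j. i \<le> j \<and> j < length \<Phi>}"

definition depth_poset ::
  "('a, 'k::field) lefschetz \<Rightarrow> ('a \<Rightarrow> real) \<Rightarrow> (('a \<times> 'a) \<times> ('a \<times> 'a)) set" where
  "depth_poset K f =
     {(p, q). p \<in> BD K f \<and> q \<in> BD K f \<and> (\<forall>\<Phi>. shallow_order K f \<Phi> \<longrightarrow> (p, q) \<in> list_order \<Phi>)}"

section \<open>The algorithms\<close>

text \<open>
  A state \<open>(I, A, D, L)\<close> consists of the current matrix \<open>A\<close> with rows and columns indexed by \<open>I\<close>,
  and the collected sets \<open>D\<close> and \<open>L\<close>. Deleting rows and columns shrinks \<open>I\<close>.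
  All algorithms return \<open>None\<close> if a loop does not terminate.
\<close>

type_synonym ('a, 'k) state =
  "'a set \<times> ('a \<Rightarrow> 'a \<Rightarrow> 'k) \<times> ('a \<times> 'a) set \<times> ('a \<times> 'a) set"

definition nonzero_state :: "('a, 'k::field) state \<Rightarrow> bool" where
  "nonzero_state = (\<lambda>(I, A, D, L). \<exists>x\<in>I. \<exists>y\<in>I. A x y \<noteq> 0)"

definition death_step :: "('a \<Rightarrow> real) \<Rightarrow> ('a, 'k::field) state \<Rightarrow> ('a, 'k) state" where
  "death_step f = (\<lambda>(I, A, D, L).
     let s = arg_max_on f {x \<in> I. \<exists>y\<in>I. A x y \<noteq> 0};
         t = arg_min_on f {y \<in> I. A s y \<noteq> 0};
         Y = {y \<in> I. f t < f y \<and> A s y \<noteq> 0}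
     in (I - {s, t},
         (\<lambda>x y. if y \<in> Y then A x y - inverse (A s t) * A s y * A x t else A x y),
         insert (s, t) D,
         L \<union> {(t, y) | y. y \<in> Y}))"

definition DEATH ::
  "'a set \<Rightarrow> ('a \<Rightarrow> real) \<Rightarrow> ('a \<Rightarrow> 'a \<Rightarrow> 'k::field)
    \<Rightarrow> (('a \<times> 'a) set \<times> (('a \<times> 'a) \<times> ('a \<times> 'a)) set) option" where
  "DEATH X f \<Delta> =
     map_option
       (\<lambda>(I, A, D, L). (D, {((s, t), (s', t')). (s, t) \<in> D \<and> (s', t') \<in> D \<and> (t, t') \<in> L}))
       (while_option nonzero_state (death_step f) (X, \<Delta>, {}, {}))"

definition birth_step :: "('a \<Rightarrow> real) \<Rightarrow> ('a, 'k::field) state \<Rightarrow> ('a, 'k) state" where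
  "birth_step f = (\<lambda>(I, A, D, L).
     let t = arg_min_on f {y \<in> I. \<exists>x\<in>I. A x y \<noteq> 0};
         s = arg_max_on f {x \<in> I. A x t \<noteq> 0};
         Z = {x \<in> I. f x < f s \<and> A x t \<noteq> 0}
     in (I - {s, t},
         (\<lambda>x y. if x \<in> Z then A x y - inverse (A s t) * A x t * A s y else A x y),
         insert (s, t) D,
         L \<union> {(s, x) | x. x \<in> Z}))"

definition BIRTH ::
  "'a set \<Rightarrow> ('a \<Rightarrow> real) \<Rightarrow> ('a \<Rightarrow> 'a \<Rightarrow> 'k::field)
    \<Rightarrow> (('a \<times> 'a) set \<times> (('a \<times> 'a) \<times> ('a \<times> 'a)) set) option" where
  "BIRTH X f \<Delta> =
     map_option
       (\<lambda>(I, A, D, L). (D, {((s, t), (s', t')). (s, t) \<in> D \<and> (s', t') \<in> D \<and> (s, s') \<in> L}))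
       (while_option nonzero_state (birth_step f) (X, \<Delta>, {}, {}))"

text \<open>
  The transitive closure of a relation on a ground set \<open>P\<close> is reflexive on \<open>P\<close>. The ground set
  used by the algorithm is the set of pairs it has collected, not the a priori given \<open>BD\<close>.
\<close>

definition closure_on :: "'b set \<Rightarrow> ('b \<times> 'b) set \<Rightarrow> ('b \<times> 'b) set" where
  "closure_on P R = {(p, q). p \<in> P \<and> q \<in> P \<and> (p, q) \<in> R\<^sup>*}"

definition DEPTH_POSET ::
  "'a set \<Rightarrow> ('a \<Rightarrow> real) \<Rightarrow> ('a \<Rightarrow> 'a \<Rightarrow> 'k::field) \<Rightarrow> (('a \<times> 'a) \<times> ('a \<times> 'a)) set option" where
  "DEPTH_POSET X f \<Delta> =
     (case (DEATH X f \<Delta>, BIRTH X f \<Delta>) of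
        (Some (D1, R1), Some (D2, R2)) \<Rightarrow> Some (closure_on (D1 \<union> D2) (R1 \<union> R2))
      | _ \<Rightarrow> None)"

end

theory Submission
  imports Defs
begin

text \<open>
  Row \<open>s\<close> of the boundary matrix lists the cofacets of \<open>s\<close>, and column \<open>t\<close> the facets of \<open>t\<close>.
  Cancelling a shallow pair \<open>(s, t)\<close> adds multiples of column \<open>t\<close> to later columns and multiples of
  row \<open>s\<close> to earlier rows, so it can change an entry only in a row before \<open>s\<close> and a column after
  \<open>t\<close>. The whole proof rests on this.

  \<^bold>\<open>Sorting.\<close> Two shallow pairs of the same complex can be cancelled in either order, with the same
  quotient (\<open>shallow_persists\<close>, \<open>quotient_commute\<close>). If \<open>q\<close> is shallow after cancelling \<open>p\<close> and
  has the later birth, then it was shallow before (\<open>shallow_before\<close>). Hence every sequence of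
  shallow cancellations can be sorted by descending birth, by insertion sort, without changing
  the resulting quotient (\<open>shallow_seq_sort\<close>). In particular the quotient depends only on the set of
  cancelled pairs (\<open>cancel_cong_set\<close>), and row \<open>x\<close> of the quotient depends only on those cancelled
  pairs whose birth is after \<open>x\<close> (\<open>stage_row\<close>).

  \<^bold>\<open>Birth-death pairs.\<close> Cancelling a shallow pair removes exactly this pair from the set of
  birth-death pairs (\<open>BD_quotient\<close>). So the maximal sequences of shallow cancellations enumerate the
  birth-death pairs, and DEATH, which cancels a shallow pair in each round, collects them in
  descending order of their births.

  \<^bold>\<open>The relation computed by DEATH.\<close> A link from \<open>(s, t)\<close> to \<open>(s', t')\<close> is recorded if the entry in
  row \<open>s\<close> and column \<open>t'\<close> is non-zero once all pairs with birth after \<open>s\<close> are cancelled; this entry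
  lies below \<open>s'\<close>. In a shallow order, \<open>(s', t')\<close> cannot precede \<open>(s, t)\<close>: at its turn, column \<open>t'\<close>
  vanishes below \<open>s'\<close>, and it stays so while the remaining pairs with birth after \<open>s\<close> are cancelled,
  after which the entry is the recorded one (\<open>death_rel_respected\<close>). Conversely, if all predecessors
  of \<open>(s, t)\<close> are cancelled, then column \<open>t\<close> vanishes below \<open>s\<close>: otherwise its lowest non-zero entry
  survives the cancellation of all later births, and its row is then the birth of an uncancelled
  predecessor (\<open>column_clear_if_predecessors_cancelled\<close>).

  \<^bold>\<open>Duality.\<close> Transposing the matrix and reversing the filter exchanges births with deaths and DEATH
  with BIRTH, so the links of BIRTH govern the rows in the same way. Therefore the shallow orders are
  precisely the linear extensions of the union of both relations
  (\<open>shallow_order_iff_linear_extension\<close>), and the intersection of all linear extensions of an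
  acyclic relation is its reflexive transitive closure.
\<close>

section \<open>Cancelling a shallow pair\<close>

definition filtered_lefschetz :: "('a, 'k::field) lefschetz \<Rightarrow> ('a \<Rightarrow> real) \<Rightarrow> bool" where
  "filtered_lefschetz K f \<longleftrightarrow> lefschetz_complex K \<and> filter_on K f"

lemma quotient_simps [simp]:
  "cells (quotient K (s, t)) = cells K - {s, t}"
  "cdim (quotient K (s, t)) = cdim K"
  "inc (quotient K (s, t)) y x = inc K y x - inverse (inc K t s) * inc K y s * inc K t x"
  by (simp_all add: quotient_def)

lemma finite_cells: "filtered_lefschetz K f \<Longrightarrow> finite (cells K)"
  by (simp add: filtered_lefschetz_def lefschetz_complex_def)

lemma filter_inj:
  "filtered_lefschetz K f \<Longrightarrow> x \<in> cells K \<Longrightarrow> y \<in> cells K \<Longrightarrow> f x = f y \<Longrightarrow> x = y"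
  by (auto simp: filtered_lefschetz_def filter_on_def inj_on_def)

lemma facet_less: "filtered_lefschetz K f \<Longrightarrow> facet K x y \<Longrightarrow> f x < f y"
  by (auto simp: filtered_lefschetz_def filter_on_def)

lemma boundary_squared:
  "filtered_lefschetz K f \<Longrightarrow> z \<in> cells K \<Longrightarrow> x \<in> cells K \<Longrightarrow>
     (\<Sum>y\<in>cells K. inc K z y * inc K y x) = 0"
  by (simp add: filtered_lefschetz_def lefschetz_complex_def)

lemma shallow_pairD:
  assumes "filtered_lefschetz K f" "(s, t) \<in> SH K f"
  shows "s \<in> cells K" "t \<in> cells K" "inc K t s \<noteq> 0" "f s < f t" "s \<noteq> t"
    "\<And>x. x \<in> cells K \<Longrightarrow> inc K t x \<noteq> 0 \<Longrightarrow> f x \<le> f s"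
    "\<And>y. y \<in> cells K \<Longrightarrow> inc K y s \<noteq> 0 \<Longrightarrow> f t \<le> f y"
  using assms facet_less[OF assms(1), of s t] by (auto simp: SH_def facet_def)

text \<open>
  The formula for the quotient gives zero on row \<open>s\<close> and column \<open>t\<close>, so that sums over the cells of
  the quotient may be taken over all cells of the original complex.
\<close>

lemma cancelled_row_and_column:
  assumes "inc K t s \<noteq> 0"
  shows "inc (quotient K (s, t)) y s = 0" "inc (quotient K (s, t)) t x = 0"
  using assms by auto

text \<open>
  The boundary operator of the quotient squares to zero because its square expands into a
  combination of values of the squared original one. The filter stays compatible because a new facet \<open>x\<close> of
  \<open>y\<close> comes from a zigzag with \<open>f x \<le> f s < f t \<le> f y\<close>.
\<close>

lemma filtered_lefschetz_quotient:
  assumes K: "filtered_lefschetz K f" and p: "p \<in> SH K f"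
  shows "filtered_lefschetz (quotient K p) f"
proof -
  obtain s t where [simp]: "p = (s, t)" by (cases p)
  note st = shallow_pairD[OF K p[simplified]]
  let ?Q = "quotient K (s, t)"
  have sum0: "(\<Sum>y\<in>cells ?Q. inc ?Q z y * inc ?Q y x) = 0"
    if z: "z \<in> cells K" and x: "x \<in> cells K" for z x
  proof -
    let ?c = "inverse (inc K t s)"
    note b = boundary_squared[OF K]
    have "(\<Sum>y\<in>cells ?Q. inc ?Q z y * inc ?Q y x) = (\<Sum>y\<in>cells K. inc ?Q z y * inc ?Q y x)"
      using finite_cells[OF K] cancelled_row_and_column[OF st(3)]
      by (intro sum.mono_neutral_left) (auto simp del: quotient_simps(3))
    also have "\<dots> = (\<Sum>y\<in>cells K. inc K z y * inc K y x)
        - ?c * inc K t x * (\<Sum>y\<in>cells K. inc K z y * inc K y s)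
        - ?c * inc K z s * (\<Sum>y\<in>cells K. inc K t y * inc K y x)
        + ?c * ?c * inc K z s * inc K t x * (\<Sum>y\<in>cells K. inc K t y * inc K y s)"
      by (simp add: sum_distrib_left flip: sum_subtractf sum.distrib) (simp add: algebra_simps)
    also have "\<dots> = 0"
      using b[OF z x] b[OF z st(1)] b[OF st(2) x] b[OF st(2) st(1)] by simp
    finally show ?thesis .
  qed
  have dim: "cdim K y = cdim K x + 1"
    if "y \<in> cells K" "x \<in> cells K" "inc K y x \<noteq> 0" for x y
    using K that by (auto simp: filtered_lefschetz_def lefschetz_complex_def)
  have cases': "inc K y x \<noteq> 0 \<or> inc K y s \<noteq> 0 \<and> inc K t x \<noteq> 0" if "inc ?Q y x \<noteq> 0" for x y
    using that by auto
  have dimQ: "cdim K y = cdim K x + 1"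
    if "y \<in> cells K" "x \<in> cells K" "inc ?Q y x \<noteq> 0" for x y
    using cases'[OF that(3)] dim[of y x] dim[of y s] dim[of t x] dim[of t s] that(1,2) st(1-3) by auto
  have lessQ: "f x < f y"
    if yx: "y \<in> cells K" "x \<in> cells K" "inc ?Q y x \<noteq> 0" for x y
    using cases'[OF yx(3)] facet_less[OF K, of x y] st(4) st(6)[of x] st(7)[of y] yx(1,2)
    by (auto simp: facet_def)
  have "inj_on f (cells K - {s, t})"
    using K by (auto simp: filtered_lefschetz_def filter_on_def inj_on_def)
  then show ?thesis
    using sum0 dimQ lessQ finite_cells[OF K]
    unfolding filtered_lefschetz_def lefschetz_complex_def filter_on_def facet_def
    by (auto simp del: quotient_simps(3))
qed

text \<open>
  The partner in a shallow pair is an extremal facet or cofacet, hence determined by the cell. A cell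
  cannot be the death of one shallow pair and the birth of another, since the composite of both
  incidences would be the only contribution to a coefficient of the squared boundary operator.
\<close>

lemma shallow_pairs_disjoint:
  assumes K: "filtered_lefschetz K f" and p: "(s, t) \<in> SH K f" and q: "(s', t') \<in> SH K f"
    and ne: "(s, t) \<noteq> (s', t')"
  shows "s \<noteq> s'" "t \<noteq> t'" "s \<noteq> t'" "t \<noteq> s'"
proof -
  have same_birth: False if "(a, b) \<in> SH K f" "(a, b') \<in> SH K f" "b \<noteq> b'" for a b b'
    using shallow_pairD[OF K that(1)] shallow_pairD[OF K that(2)] filter_inj[OF K, of b b'] that(3)
    by (meson order_antisym)
  have same_death: False if "(a, b) \<in> SH K f" "(a', b) \<in> SH K f" "a \<noteq> a'" for a a' b
    using shallow_pairD[OF K that(1)] shallow_pairD[OF K that(2)] filter_inj[OF K, of a a'] that(3)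
    by (meson order_antisym)
  have chain: False if ab: "(a, b) \<in> SH K f" and bc: "(b, c) \<in> SH K f" for a b c
  proof -
    note ab = shallow_pairD[OF K ab] and bc = shallow_pairD[OF K bc]
    have "(\<Sum>y\<in>cells K. inc K c y * inc K y a) = 0"
      using boundary_squared[OF K bc(2) ab(1)] .
    moreover have "inc K c y * inc K y a = 0" if "y \<in> cells K - {b}" for y
      using ab(7)[of y] bc(6)[of y] filter_inj[OF K, of y b] that ab(2) by force
    ultimately have "inc K c b * inc K b a = 0"
      using sum.remove[OF finite_cells[OF K] ab(2), of "\<lambda>y. inc K c y * inc K y a"] by simp
    then show False using ab(3) bc(3) by simp
  qed
  show "s \<noteq> s'" using same_birth p q ne by blast
  show "t \<noteq> t'" using same_death p q ne by blast
  show "s \<noteq> t'" "t \<noteq> s'" using chain p q by blast+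
qed

text \<open>
  If both entries were non-zero, then \<open>s\<close> and \<open>s'\<close> would bound each other from above and
  hence be equal. This makes the
  block on two shallow pairs an invertible triangular matrix, so that eliminating both pairs is the
  same Schur complement in either order.
\<close>

lemma shallow_pairs_triangular:
  assumes K: "filtered_lefschetz K f" and p: "(s, t) \<in> SH K f" and q: "(s', t') \<in> SH K f"
    and ne: "(s, t) \<noteq> (s', t')"
  shows "inc K t s' = 0 \<or> inc K t' s = 0"
  using shallow_pairD[OF K p] shallow_pairD[OF K q] shallow_pairs_disjoint[OF assms] filter_inj[OF K, of s s']
  by (meson order_antisym)

lemma shallow_persists:
  assumes K: "filtered_lefschetz K f" and p: "p \<in> SH K f" and q: "q \<in> SH K f" and ne: "p \<noteq> q"
  shows "q \<in> SH (quotient K p) f"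
proof -
  obtain s t s' t' where [simp]: "p = (s, t)" "q = (s', t')" by (cases p, cases q)
  have pq: "(s, t) \<in> SH K f" "(s', t') \<in> SH K f" "(s, t) \<noteq> (s', t')"
    using p q ne by auto
  note st = shallow_pairD[OF K pq(1)] and st' = shallow_pairD[OF K pq(2)]
  note dis = shallow_pairs_disjoint[OF K pq] and tri = shallow_pairs_triangular[OF K pq]
  have "f x \<le> f s'" if "x \<in> cells K" "inc (quotient K p) t' x \<noteq> 0" for x
    using that st(1) st(6)[of x] st'(6)[of x] st'(6)[of s] st' by (cases "inc K t' x = 0") force+
  moreover have "f t' \<le> f y" if "y \<in> cells K" "inc (quotient K p) y s' \<noteq> 0" for y
    using that st(2) st(7)[of y] st'(7)[of y] st'(7)[of t] by (cases "inc K y s' = 0") force+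
  ultimately show ?thesis
    using dis tri st' ne by (auto simp: SH_def facet_def)
qed

lemma quotient_commute:
  assumes K: "filtered_lefschetz K f" and p: "p \<in> SH K f" and q: "q \<in> SH K f" and ne: "p \<noteq> q"
  shows "quotient (quotient K p) q = quotient (quotient K q) p"
proof -
  obtain s t s' t' where [simp]: "p = (s, t)" "q = (s', t')" by (cases p, cases q)
  have pq: "(s, t) \<in> SH K f" "(s', t') \<in> SH K f" "(s, t) \<noteq> (s', t')"
    using p q ne by auto
  note st = shallow_pairD[OF K pq(1)] and st' = shallow_pairD[OF K pq(2)]
  note tri = shallow_pairs_triangular[OF K pq]
  have "inc (quotient (quotient K p) q) y x = inc (quotient (quotient K q) p) y x" for y x
    using tri st(3) st'(3) by (auto simp: field_simps)
  then show ?thesis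
    by (intro lefschetz.equality) (auto simp: fun_eq_iff)
qed

text \<open>
  Only entries in rows up to \<open>fst p\<close> are changed by cancelling \<open>p\<close>. So the row of a later birth
  \<open>fst q\<close>, and everything below it in the column \<open>snd q\<close>, is the same before and after. What remains
  is to exclude that one of the two cells of \<open>p\<close> spoils the condition.
\<close>

lemma shallow_before:
  assumes K: "filtered_lefschetz K f" and p: "p \<in> SH K f" and q: "q \<in> SH (quotient K p) f"
    and later: "f (fst p) < f (fst q)"
  shows "q \<in> SH K f"
proof -
  obtain s t s' t' where [simp]: "p = (s, t)" "q = (s', t')" by (cases p, cases q)
  have "(s, t) \<in> SH K f" "(s', t') \<in> SH (quotient K (s, t)) f"
    "filtered_lefschetz (quotient K (s, t)) f"
    using p q filtered_lefschetz_quotient[OF K p] by auto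
  note st = shallow_pairD[OF K this(1)] and st' = shallow_pairD[OF this(3,2), simplified]
  have row: "inc K t x = 0" if "x \<in> cells K" "f s < f x" for x
    using st(6)[OF that(1)] that(2) by force
  have s': "inc K t s' = 0" using row st'(1) later by simp
  have "f x \<le> f s'" if x: "x \<in> cells K" "inc K t' x \<noteq> 0" for x
  proof (rule ccontr)
    assume "\<not> f x \<le> f s'"
    then have *: "f s' < f x" by simp
    have "x \<noteq> t"
    proof
      assume [simp]: "x = t"
      \<comment> \<open>Any other path from \<open>t'\<close> to \<open>s\<close> passes through a facet of \<open>t'\<close> that survives in the quotient
          above \<open>s'\<close>, which is impossible; so the path through \<open>t\<close> cannot be compensated.\<close>
      have "inc K t' y * inc K y s = 0" if y: "y \<in> cells K - {t}" for y
      proof (rule ccontr)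
        assume "inc K t' y * inc K y s \<noteq> 0"
        then have nz: "inc K t' y \<noteq> 0" "inc K y s \<noteq> 0" by auto
        then have "f t \<le> f y" using st(7) y by blast
        then have "f s < f y" "y \<noteq> s" "f s' < f y" using st(4) * by auto
        then show False using nz(1) row[of y] y st'(6)[of y] by force
      qed
      then have "(\<Sum>y\<in>cells K - {t}. inc K t' y * inc K y s) = 0" by (intro sum.neutral) blast
      then have "inc K t' t * inc K t s = 0"
        using sum.remove[OF finite_cells[OF K] st(2), of "\<lambda>y. inc K t' y * inc K y s"]
          boundary_squared[OF K, of t' s] st(1) st'(2) by simp
      then show False using x(2) st(3) by simp
    qed
    moreover have "f s < f x" using * later by simp
    ultimately show False using row[OF x(1)] st'(6)[of x] * x by force
  qed
  moreover have "f t' \<le> f y" if y: "y \<in> cells K" "inc K y s' \<noteq> 0" for y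
  proof -
    have "y \<noteq> t" using y s' by auto
    moreover have False if "y = s"
      using that y facet_less[OF K, of s' s] st'(1) later st(1) by (auto simp: facet_def)
    ultimately show ?thesis using st'(7)[of y] y s' by force
  qed
  ultimately show ?thesis using st' s' by (auto simp: SH_def facet_def)
qed

section \<open>Sequences of cancellations and their sorting\<close>

fun shallow_seq :: "('a, 'k::field) lefschetz \<Rightarrow> ('a \<Rightarrow> real) \<Rightarrow> ('a \<times> 'a) list \<Rightarrow> bool" where
  "shallow_seq K f [] = True"
| "shallow_seq K f (p # ps) = (p \<in> SH K f \<and> shallow_seq (quotient K p) f ps)"

abbreviation cancel :: "('a, 'k::field) lefschetz \<Rightarrow> ('a \<times> 'a) list \<Rightarrow> ('a, 'k) lefschetz" where
  "cancel K ps \<equiv> foldl quotient K ps"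

lemma shallow_seq_append [simp]:
  "shallow_seq K f (ps @ qs) \<longleftrightarrow> shallow_seq K f ps \<and> shallow_seq (cancel K ps) f qs"
  by (induction ps arbitrary: K) auto

lemma shallow_seq_iff_nth:
  "shallow_seq K f ps \<longleftrightarrow> (\<forall>i<length ps. ps ! i \<in> SH (cancel K (take i ps)) f)"
  by (induction ps arbitrary: K) (auto simp: All_less_Suc2)

lemma filtered_lefschetz_cancel:
  "filtered_lefschetz K f \<Longrightarrow> shallow_seq K f ps \<Longrightarrow> filtered_lefschetz (cancel K ps) f"
  by (induction ps arbitrary: K) (auto simp: filtered_lefschetz_quotient)

lemma cells_cancel: "cells (cancel K ps) = cells K - fst ` set ps - snd ` set ps"
  by (induction ps arbitrary: K) auto

lemma shallow_seq_cells:
  "filtered_lefschetz K f \<Longrightarrow> shallow_seq K f ps \<Longrightarrow> p \<in> set ps \<Longrightarrow>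
     fst p \<in> cells K \<and> snd p \<in> cells K \<and> f (fst p) < f (snd p)"
proof (induction ps arbitrary: K)
  case (Cons q ps)
  obtain s t where [simp]: "q = (s, t)" by (cases q)
  show ?case
    using Cons.prems shallow_pairD[of K f s t] Cons.IH[OF filtered_lefschetz_quotient[of K f q]] by auto
qed simp

lemma shallow_seq_distinct:
  assumes "filtered_lefschetz K f" "shallow_seq K f ps"
  shows "distinct ps"
    and "p \<in> set ps \<Longrightarrow> q \<in> set ps \<Longrightarrow> p \<noteq> q \<Longrightarrow> {fst p, snd p} \<inter> {fst q, snd q} = {}"
proof -
  have "distinct ps \<and> (\<forall>p\<in>set ps. \<forall>q\<in>set ps. p \<noteq> q \<longrightarrow> {fst p, snd p} \<inter> {fst q, snd q} = {})"
    using assms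
  proof (induction ps arbitrary: K)
    case (Cons q ps)
    obtain s t where [simp]: "q = (s, t)" by (cases q)
    have Q: "filtered_lefschetz (quotient K q) f" "shallow_seq (quotient K q) f ps"
      using Cons.prems filtered_lefschetz_quotient by auto
    have "{fst r, snd r} \<inter> {s, t} = {}" if "r \<in> set ps" for r
      using shallow_seq_cells[OF Q that] by auto
    then show ?case using Cons.IH[OF Q] by fastforce
  qed simp
  then show "distinct ps"
    and "p \<in> set ps \<Longrightarrow> q \<in> set ps \<Longrightarrow> p \<noteq> q \<Longrightarrow> {fst p, snd p} \<inter> {fst q, snd q} = {}"
    by blast+
qed

lemma shallow_seq_uncancelled:
  assumes "filtered_lefschetz K f" "shallow_seq K f ps" "p \<in> set ps" "set qs \<subseteq> set ps - {p}"
  shows "{fst p, snd p} \<subseteq> cells (cancel K qs)"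
proof -
  have "{fst p, snd p} \<inter> {fst q, snd q} = {}" if "q \<in> set qs" for q
    using shallow_seq_distinct(2)[OF assms(1-3), of q] assms(4) that by blast
  then show ?thesis
    using shallow_seq_cells[OF assms(1-3)] by (fastforce simp: cells_cancel)
qed

text \<open>
  Sorting by this key puts late births first, as in the order in which DEATH finds them.
\<close>

abbreviation birth_key :: "('a \<Rightarrow> real) \<Rightarrow> 'a \<times> 'a \<Rightarrow> real" where
  "birth_key f p \<equiv> - f (fst p)"

text \<open>
  Insertion moves \<open>p\<close> past pairs with a later birth. Such a pair is already shallow before \<open>p\<close> is
  cancelled, so the two cancellations commute.
\<close>

lemma shallow_seq_insort:
  assumes "filtered_lefschetz K f" "shallow_seq K f (p # ps)"
  shows "shallow_seq K f (insort_key (birth_key f) p ps) \<and>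
         cancel K (insort_key (birth_key f) p ps) = cancel K (p # ps)"
  using assms
proof (induction ps arbitrary: K)
  case (Cons q ps)
  show ?case
  proof (cases "birth_key f p \<le> birth_key f q")
    case False
    then have q: "q \<in> SH K f" and ne: "q \<noteq> p" and p: "p \<in> SH K f"
      using shallow_before[OF Cons.prems(1), of p q] Cons.prems(2) by auto
    note comm = quotient_commute[OF Cons.prems(1) p q ne[symmetric]]
    show ?thesis
      using Cons.IH[OF filtered_lefschetz_quotient[OF Cons.prems(1) q]] Cons.prems(2) False q comm
        shallow_persists[OF Cons.prems(1) q p ne] by auto
  qed (use Cons.prems in auto)
qed simp

lemma shallow_seq_sort:
  assumes "filtered_lefschetz K f" "shallow_seq K f ps"
  shows "shallow_seq K f (sort_key (birth_key f) ps) \<and>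
         cancel K (sort_key (birth_key f) ps) = cancel K ps"
  using assms
proof (induction ps arbitrary: K)
  case (Cons p ps)
  then show ?case
    using Cons.IH[OF filtered_lefschetz_quotient[OF Cons.prems(1), of p]]
      shallow_seq_insort[OF Cons.prems(1), of p "sort_key (birth_key f) ps"] by auto
qed simp

lemma cancel_cong_set:
  assumes K: "filtered_lefschetz K f" and ps: "shallow_seq K f ps" and qs: "shallow_seq K f qs"
    and eq: "set ps = set qs"
  shows "cancel K ps = cancel K qs"
proof -
  have inj: "inj_on (birth_key f) (set ps)"
  proof (rule inj_onI)
    fix p q assume pq: "p \<in> set ps" "q \<in> set ps" "birth_key f p = birth_key f q"
    then have "fst p = fst q"
      using filter_inj[OF K] shallow_seq_cells[OF K ps] by auto
    then show "p = q" using shallow_seq_distinct(2)[OF K ps] pq by blast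
  qed
  have "sort_key (birth_key f) ps = sort_key (birth_key f) qs"
    using inj eq shallow_seq_distinct(1)[OF K ps] shallow_seq_distinct(1)[OF K qs]
    by (intro map_sorted_distinct_set_unique[where f = "birth_key f"]) (auto simp: distinct_map)
  then show ?thesis using shallow_seq_sort[OF K ps] shallow_seq_sort[OF K qs] by metis
qed

section \<open>Birth-death pairs as lowest attainable pivots\<close>

definition chain_boundary :: "('a, 'k::field) lefschetz \<Rightarrow> ('a \<Rightarrow> 'k) \<Rightarrow> 'a \<Rightarrow> 'k" where
  "chain_boundary K v x = (\<Sum>z\<in>cells K. v z * inc K z x)"

text \<open>
  Some chain with leading cell \<open>t\<close> has a boundary that vanishes on \<open>U\<close>. The sets \<open>U\<close> of interest
  consist of all cells beyond a threshold: then this measures how low the boundary of such a chain has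
  to reach, which is what a reduced form optimizes in each column.
\<close>

definition clearable ::
  "('a, 'k::field) lefschetz \<Rightarrow> ('a \<Rightarrow> real) \<Rightarrow> 'a \<Rightarrow> 'a set \<Rightarrow> bool" where
  "clearable K f t U \<longleftrightarrow>
     (\<exists>v. v t = 1 \<and> (\<forall>z\<in>cells K. f t < f z \<longrightarrow> v z = 0) \<and>
          (\<forall>x\<in>cells K \<inter> U. chain_boundary K v x = 0))"

lemma clearable_mono: "clearable K f t U \<Longrightarrow> V \<inter> cells K \<subseteq> U \<Longrightarrow> clearable K f t V"
  unfolding clearable_def by blast

text \<open>
  The pairs \<open>(s, t)\<close> such that \<open>s\<close> is the earliest possible pivot of the boundary of a chain with
  leading cell \<open>t\<close>. No matrix reduction is mentioned here, which makes this form convenient for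
  comparing a complex with its quotient.
\<close>

definition min_low_pairs :: "('a, 'k::field) lefschetz \<Rightarrow> ('a \<Rightarrow> real) \<Rightarrow> ('a \<times> 'a) set" where
  "min_low_pairs K f = {(s, t). s \<in> cells K \<and> t \<in> cells K \<and>
     clearable K f t {x. f s < f x} \<and> \<not> clearable K f t {x. f s \<le> f x}}"

lemma chain_boundary_diff:
  "chain_boundary K (\<lambda>z. v z - a * w z) x = chain_boundary K v x - a * chain_boundary K w x"
  by (simp add: chain_boundary_def sum_distrib_left sum_subtractf left_diff_distrib mult.assoc)

lemma chain_boundary_twice:
  assumes K: "filtered_lefschetz K f" and x: "x \<in> cells K"
  shows "chain_boundary K (chain_boundary K v) x = 0"
proof -
  have "chain_boundary K (chain_boundary K v) x
      = (\<Sum>y\<in>cells K. \<Sum>z\<in>cells K. v z * (inc K z y * inc K y x))"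
    by (simp add: chain_boundary_def sum_distrib_right mult.assoc)
  also have "\<dots> = (\<Sum>z\<in>cells K. v z * (\<Sum>y\<in>cells K. inc K z y * inc K y x))"
    by (subst sum.swap) (simp add: sum_distrib_left)
  finally show ?thesis using boundary_squared[OF K _ x] by simp
qed

text \<open>
  The quotient is the chain complex modulo \<open>t\<close> and its boundary. Projection and inclusion are chain
  maps that preserve leading cells, since the corrections are multiples of \<open>t\<close> or of its boundary,
  and shallowness places these below the leading cell whenever they occur.
\<close>

lemma clearable_quotient:
  assumes K: "filtered_lefschetz K f" and p: "(s, t) \<in> SH K f" and y: "y \<in> cells (quotient K (s, t))"
    and U: "\<And>a b. a \<in> U \<Longrightarrow> f a \<le> f b \<Longrightarrow> b \<in> U"
  shows "clearable (quotient K (s, t)) f y U \<longleftrightarrow> clearable K f y U"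
proof
  note st = shallow_pairD[OF K p]
  let ?Q = "quotient K (s, t)" and ?c = "inverse (inc K t s)"
  assume "clearable K f y U"
  then obtain v where v: "v y = 1" "\<And>z. z \<in> cells K \<Longrightarrow> f y < f z \<Longrightarrow> v z = 0"
    "\<And>x. x \<in> cells K \<Longrightarrow> x \<in> U \<Longrightarrow> chain_boundary K v x = 0"
    unfolding clearable_def by blast
  \<comment> \<open>Add the multiple of the boundary of \<open>t\<close> that removes \<open>s\<close>.\<close>
  define w where "w = (\<lambda>z. v z - v s * ?c * inc K t z)"
  have ws: "w s = 0" using st(3) by (simp add: w_def)
  have vs: "v s * inc K t z = 0" if "z \<in> cells K" "f y \<le> f z" for z
  proof (cases "inc K t z = 0")
    case False
    then have "f y \<le> f s" using st(6)[OF that(1)] that(2) by simp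
    moreover have "y \<noteq> s" "y \<in> cells K" using y by auto
    ultimately have "f y < f s" using filter_inj[OF K _ st(1), of y] by force
    then show ?thesis using v(2) st(1) by simp
  qed simp
  have "w y = 1" using vs[of y] y v(1) by (auto simp: w_def)
  moreover have "w z = 0" if "z \<in> cells K" "f y < f z" for z
    using vs[of z] v(2)[of z] that by (auto simp: w_def)
  moreover have "chain_boundary ?Q w x = 0" if x: "x \<in> cells K" "x \<in> U" for x
  proof -
    have bw: "(\<Sum>z\<in>cells K. w z * inc K z x) = chain_boundary K v x" if x: "x \<in> cells K" for x
    proof -
      have "(\<Sum>z\<in>cells K. w z * inc K z x)
          = chain_boundary K v x - v s * ?c * (\<Sum>z\<in>cells K. inc K t z * inc K z x)"
        by (simp add: chain_boundary_def w_def sum_distrib_left algebra_simps flip: sum_subtractf)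
      then show ?thesis using boundary_squared[OF K st(2) x] by simp
    qed
    have "chain_boundary ?Q w x = (\<Sum>z\<in>cells K. w z * inc ?Q z x)"
      unfolding chain_boundary_def using finite_cells[OF K] ws cancelled_row_and_column[OF st(3)]
      by (intro sum.mono_neutral_left) (auto simp del: quotient_simps(3))
    also have "\<dots> = (\<Sum>z\<in>cells K. w z * inc K z x)
        - ?c * inc K t x * (\<Sum>z\<in>cells K. w z * inc K z s)"
      by (simp add: sum_distrib_left algebra_simps flip: sum_subtractf)
    also have "\<dots> = - ?c * inc K t x * chain_boundary K v s"
      using bw[OF x(1)] bw[OF st(1)] v(3)[OF x] by simp
    also have "\<dots> = 0"
      using st(1) st(6)[OF x(1)] U[OF x(2), of s] v(3)[of s] by auto
    finally show ?thesis .
  qed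
  ultimately show "clearable ?Q f y U"
    unfolding clearable_def by (intro exI[of _ w]) auto
next
  note st = shallow_pairD[OF K p]
  let ?Q = "quotient K (s, t)" and ?c = "inverse (inc K t s)"
  assume "clearable ?Q f y U"
  then obtain w where w: "w y = 1" "\<And>z. z \<in> cells ?Q \<Longrightarrow> f y < f z \<Longrightarrow> w z = 0"
    "\<And>x. x \<in> cells ?Q \<Longrightarrow> x \<in> U \<Longrightarrow> chain_boundary ?Q w x = 0"
    unfolding clearable_def by blast
  \<comment> \<open>Add the multiple of \<open>t\<close> that removes \<open>s\<close> from the boundary.\<close>
  define ct where "ct = - ?c * (\<Sum>z\<in>cells ?Q. w z * inc K z s)"
  define v where "v = (\<lambda>z. if z = t then ct else if z = s then 0 else w z)"
  have cells: "cells K = insert s (insert t (cells ?Q))" using st(1,2) by auto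
  have fin: "finite (cells ?Q)" using finite_cells[OF K] by simp
  have bv: "chain_boundary K v x = chain_boundary ?Q w x" for x
  proof -
    have "chain_boundary K v x = ct * inc K t x + (\<Sum>z\<in>cells ?Q. w z * inc K z x)"
      unfolding chain_boundary_def cells using fin st(5)
      by (auto simp: v_def intro!: sum.cong)
    then show ?thesis
      by (simp add: chain_boundary_def ct_def sum_distrib_left algebra_simps sum_subtractf sum_negf sum.distrib del: quotient_simps(1))
  qed
  have bs: "chain_boundary K v s = 0"
    unfolding bv by (simp add: chain_boundary_def cancelled_row_and_column[OF st(3)] del: quotient_simps)
  have bt: "chain_boundary K v t = 0" if t: "t \<in> U"
  proof -
    have "chain_boundary K v z * inc K z s = 0" if z: "z \<in> cells K - {t}" for z
      using z bs bv[of z] w(3)[of z] st(7)[of z] U[OF t, of z] by (cases "z = s") auto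
    then have "chain_boundary K (chain_boundary K v) s = chain_boundary K v t * inc K t s"
      using sum.remove[OF finite_cells[OF K] st(2), of "\<lambda>z. chain_boundary K v z * inc K z s"]
      unfolding chain_boundary_def[of _ "chain_boundary K v"] by (simp del: mult_eq_0_iff)
    then show ?thesis using chain_boundary_twice[OF K st(1)] st(3) by simp
  qed
  have "v z = 0" if z: "z \<in> cells K" "f y < f z" for z
  proof -
    have "ct = 0" if "f y < f t"
    proof -
      have "w z * inc K z s = 0" if "z \<in> cells ?Q" for z
        using st(7)[of z] w(2)[of z] that \<open>f y < f t\<close> by fastforce
      then show ?thesis unfolding ct_def by (simp del: quotient_simps mult_eq_0_iff)
    qed
    then show ?thesis using w(2)[of z] z by (auto simp: v_def)
  qed
  moreover have "chain_boundary K v x = 0" if x: "x \<in> cells K" "x \<in> U" for x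
    using x bs bt w(3)[of x] bv[of x] by (cases "x = s \<or> x = t") auto
  moreover have "v y = 1" using y w(1) by (auto simp: v_def)
  ultimately show "clearable K f y U"
    unfolding clearable_def by (intro exI[of _ v]) auto
qed

text \<open>
  The boundary of any chain with leading cell \<open>t\<close> has a non-zero coefficient at \<open>s\<close>, as no earlier cell
  has \<open>s\<close> in its boundary, and the boundary of \<open>t\<close> is a cycle with leading cell \<open>s\<close>. The other cells
  are compared by the previous lemma.
\<close>

lemma min_low_pairs_quotient:
  assumes K: "filtered_lefschetz K f" and p: "p \<in> SH K f"
  shows "min_low_pairs K f = insert p (min_low_pairs (quotient K p) f)"
proof -
  obtain s t where [simp]: "p = (s, t)" by (cases p)
  have p': "(s, t) \<in> SH K f" using p by simp
  note st = shallow_pairD[OF K p']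
  let ?Q = "quotient K (s, t)"
  have eq: "clearable ?Q f b {x. f a < f x} \<longleftrightarrow> clearable K f b {x. f a < f x}"
           "clearable ?Q f b {x. f a \<le> f x} \<longleftrightarrow> clearable K f b {x. f a \<le> f x}"
    if "b \<in> cells ?Q" for a b
    by (rule clearable_quotient[OF K p' that]; simp)+
  have s_clear: "clearable K f s U" for U
  proof -
    have "chain_boundary K (\<lambda>z. inverse (inc K t s) * inc K t z) x = 0" if "x \<in> cells K" for x
      using boundary_squared[OF K st(2) that]
      by (simp add: chain_boundary_def mult.assoc flip: sum_distrib_left)
    moreover have "inc K t z = 0" if "z \<in> cells K" "f s < f z" for z
      using st(6)[of z] that by force
    ultimately show ?thesis
      unfolding clearable_def using st(3)
      by (intro exI[of _ "\<lambda>z. inverse (inc K t s) * inc K t z"]) auto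
  qed
  have t_clear: "clearable K f t {x. f s < f x}"
  proof -
    have "chain_boundary K (\<lambda>z. if z = t then 1 else 0) x = inc K t x" for x
      using finite_cells[OF K] st(2) by (simp add: chain_boundary_def if_distrib if_distribR cong: if_cong)
    then show ?thesis
      unfolding clearable_def using st(6)
      by (intro exI[of _ "\<lambda>z. if z = t then 1 else 0"]) force
  qed
  have t_not: "\<not> clearable K f t U" if "s \<in> U" for U
  proof
    assume "clearable K f t U"
    then obtain v where v: "v t = 1" "\<And>z. z \<in> cells K \<Longrightarrow> f t < f z \<Longrightarrow> v z = 0"
      and "\<forall>x\<in>cells K \<inter> U. chain_boundary K v x = 0"
      unfolding clearable_def by blast
    then have bs: "chain_boundary K v s = 0" using \<open>s \<in> U\<close> st(1) by simp
    have "v z * inc K z s = 0" if z: "z \<in> cells K - {t}" for z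
    proof (cases "inc K z s = 0")
      case False
      then have "f t \<le> f z" using st(7)[of z] z by simp
      moreover have "f t \<noteq> f z" using filter_inj[OF K st(2), of z] z by auto
      ultimately show ?thesis using v(2)[of z] z by simp
    qed simp
    then have "chain_boundary K v s = inc K t s"
      using sum.remove[OF finite_cells[OF K] st(2), of "\<lambda>z. v z * inc K z s"] v(1)
      unfolding chain_boundary_def by (simp del: mult_eq_0_iff)
    then show False using bs st(3) by simp
  qed
  \<comment> \<open>A removed cell cannot be an optimum: the thresholds just below and above it agree on the quotient.\<close>
  have gap: "clearable ?Q f b {x. f a \<le> f x}"
    if "clearable ?Q f b {x. f a < f x}" "a \<in> cells K" "a \<notin> cells ?Q" for a b
  proof (rule clearable_mono[OF that(1)], safe)
    fix x assume x: "f a \<le> f x" "x \<in> cells ?Q"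
    then have "f a \<noteq> f x" using that(2,3) filter_inj[OF K that(2), of x] by auto
    then show "f a < f x" using x(1) by simp
  qed
  have "(a, b) \<in> min_low_pairs K f \<longleftrightarrow> (a, b) = (s, t) \<or> (a, b) \<in> min_low_pairs ?Q f" for a b
  proof (cases "b = t")
    case True
    have "a = s" if a: "a \<in> cells K" "clearable K f t {x. f a < f x}" "\<not> clearable K f t {x. f a \<le> f x}"
    proof -
      have "\<not> f a < f s" using t_not[of "{x. f a < f x}"] a(2) by blast
      moreover have "\<not> f s < f a"
      proof
        assume "f s < f a"
        then have "{x. f a \<le> f x} \<inter> cells K \<subseteq> {x. f s < f x}" by auto
        then show False using clearable_mono[OF t_clear] a(3) by blast
      qed
      ultimately show ?thesis using filter_inj[OF K a(1) st(1)] by simp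
    qed
    then show ?thesis
      using True st(1,2) t_clear t_not[of "{x. f s \<le> f x}"] by (auto simp: min_low_pairs_def)
  next
    case False
    then show ?thesis
      using s_clear eq[of b a] gap[of b a] by (auto simp: min_low_pairs_def)
  qed
  then show ?thesis by auto
qed

lemma min_low_pairs_zero:
  assumes K: "filtered_lefschetz K f" and zero: "\<And>x y. \<not> facet K x y"
  shows "min_low_pairs K f = {}"
proof -
  have "clearable K f t U" if "t \<in> cells K" for t U
    unfolding clearable_def using zero that
    by (intro exI[of _ "\<lambda>z. if z = t then 1 else 0"])
      (auto simp: chain_boundary_def facet_def intro!: sum.neutral)
  then show ?thesis by (auto simp: min_low_pairs_def)
qed

lemma mat_mult_boundary_matrix:
  "mat_mult (cells K) (boundary_matrix K) V x t = chain_boundary K (\<lambda>z. V z t) x"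
  by (simp add: mat_mult_def boundary_matrix_def chain_boundary_def mult.commute)

lemma chain_boundary_sum:
  "chain_boundary K (\<lambda>z. \<Sum>y\<in>A. c y * v y z) x = (\<Sum>y\<in>A. c y * chain_boundary K (v y) x)"
  unfolding chain_boundary_def sum_distrib_left sum_distrib_right
  by (subst sum.swap) (simp add: mult.assoc)

lemma chain_boundary_cong:
  "(\<And>z. z \<in> cells K \<Longrightarrow> v z = w z) \<Longrightarrow> chain_boundary K v x = chain_boundary K w x"
  by (simp add: chain_boundary_def)

text \<open>
  Back substitution: the leading coefficient of a vector is removed with the column of its leading index.
\<close>

lemma unitriangular_expansion:
  fixes V :: "'a \<Rightarrow> 'a \<Rightarrow> 'k::field"
  assumes fin: "finite I" and inj: "inj_on f I" and V: "unit_upper_triangular I f V"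
    and t: "t \<in> I" and w: "\<And>z. z \<in> I \<Longrightarrow> f t < f z \<Longrightarrow> w z = 0"
  obtains c where "c t = w t" "\<And>z. z \<in> I \<Longrightarrow> w z = (\<Sum>y\<in>I. c y * V z y)"
proof -
  have diag: "V z z = 1" and low: "y \<in> I \<Longrightarrow> f y < f z \<Longrightarrow> V z y = 0" if "z \<in> I" for z y
    using V that by (auto simp: unit_upper_triangular_def)
  have main: "\<exists>c. c t = w t \<and> (\<forall>z\<in>I. f t < f z \<longrightarrow> c z = 0) \<and> (\<forall>z\<in>I. w z = (\<Sum>y\<in>I. c y * V z y))"
    if "t \<in> I" "\<And>z. z \<in> I \<Longrightarrow> f t < f z \<Longrightarrow> w z = 0" for t w
    using that
  proof (induction "card {z \<in> I. f z < f t}" arbitrary: t w rule: less_induct)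
    case less
    define u where "u = (\<lambda>z. w z - w t * V z t)"
    have single: "(\<Sum>y\<in>I. (if y = t then w t else 0) * V z y) = w t * V z t" for z
      using fin less.prems(1) by (simp add: if_distrib if_distribR cong: if_cong)
    have u: "u z = 0" if "z \<in> I" "f t \<le> f z" for z
    proof (cases "z = t")
      case True
      then show ?thesis using diag[OF less.prems(1)] by (simp add: u_def)
    next
      case False
      then have "f t < f z" using that less.prems(1) inj by (metis inj_onD less_le)
      then show ?thesis using low[OF that(1) less.prems(1)] less.prems(2)[OF that(1)] by (simp add: u_def)
    qed
    show ?case
    proof (cases "{z \<in> I. f z < f t} = {}")
      case True
      then have "u z = 0" if "z \<in> I" for z using u that by force
      then show ?thesis
        by (intro exI[of _ "\<lambda>y. if y = t then w t else 0"]) (auto simp: single u_def)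
    next
      case False
      obtain r where r: "r \<in> I" "f r < f t" "\<And>z. z \<in> I \<Longrightarrow> f z < f t \<Longrightarrow> f z \<le> f r"
      proof -
        have "finite (f ` {z \<in> I. f z < f t})" using fin by simp
        then have "Max (f ` {z \<in> I. f z < f t}) \<in> f ` {z \<in> I. f z < f t}"
          using False by (intro Max_in) auto
        then obtain r where "r \<in> I" "f r < f t" "f r = Max (f ` {z \<in> I. f z < f t})" by auto
        then show ?thesis using that fin by simp
      qed
      have "{z \<in> I. f z < f r} \<subset> {z \<in> I. f z < f t}" using r by auto
      then have "card {z \<in> I. f z < f r} < card {z \<in> I. f z < f t}"
        using fin by (intro psubset_card_mono) auto
      moreover have "u z = 0" if "z \<in> I" "f r < f z" for z
        using u[OF that(1)] r(3)[OF that(1)] that(2) by force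
      ultimately obtain c where c: "\<forall>z\<in>I. f r < f z \<longrightarrow> c z = 0"
        "\<forall>z\<in>I. u z = (\<Sum>y\<in>I. c y * V z y)"
        using less.hyps[of r u] r(1) by blast
      have "c t = 0" using c(1) r(2) less.prems(1) by simp
      moreover have "w z = (\<Sum>y\<in>I. (c y + (if y = t then w t else 0)) * V z y)" if "z \<in> I" for z
        
      proof -
        have "w z = u z + w t * V z t" by (simp add: u_def)
        then show ?thesis using c(2) that single[of z] by (simp add: distrib_right sum.distrib)
      qed
      moreover have "c z = 0" if "z \<in> I" "f t < f z" for z
        using c(1) r(2) that by auto
      ultimately show ?thesis
        by (intro exI[of _ "\<lambda>y. c y + (if y = t then w t else 0)"]) auto
    qed
  qed
  from main[where t = t and w = w, OF t w] obtain c where "c t = w t" "\<And>z. z \<in> I \<Longrightarrow> w z = (\<Sum>y\<in>I. c y * V z y)"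
    by blast
  then show thesis by (rule that)
qed

lemma exists_lowest:
  assumes K: "filtered_lefschetz K f" and "x \<in> cells K" "P x"
  shows "\<exists>m\<in>cells K. P m \<and> (\<forall>x\<in>cells K. P x \<longrightarrow> f x \<le> f m)"
proof -
  let ?S = "{x \<in> cells K. P x}"
  have fin: "finite (f ` ?S)" using finite_cells[OF K] by simp
  then have "Max (f ` ?S) \<in> f ` ?S" using assms(2,3) by (intro Max_in) auto
  then obtain m where m: "m \<in> cells K" "P m" "f m = Max (f ` ?S)" by auto
  show ?thesis
    by (rule bexI[OF _ m(1)]) (use m(2) fin in \<open>auto simp: m(3) intro!: Max_ge\<close>)
qed

lemma reduced_form_pivot_min_low:
  assumes K: "filtered_lefschetz K f" and R: "reduced_form (cells K) f (boundary_matrix K) R"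
    and st: "pivot (cells K) f R s t"
  shows "(s, t) \<in> min_low_pairs K f"
proof -
  obtain V where V: "unit_upper_triangular (cells K) f V"
    and RV: "R = mat_mult (cells K) (boundary_matrix K) V"
    using R by (auto simp: reduced_form_def)
  have uniq: "t = t'" if "pivot (cells K) f R s t" "pivot (cells K) f R s t'" for s t t'
    using R that by (auto simp: reduced_form_def)
  have R_eq: "R x y = chain_boundary K (\<lambda>z. V z y) x" for x y
    by (simp add: RV mat_mult_boundary_matrix)
  have s: "s \<in> cells K" and t: "t \<in> cells K" and Rst: "R s t \<noteq> 0"
    and Rx: "x \<in> cells K \<Longrightarrow> R x t \<noteq> 0 \<Longrightarrow> f x \<le> f s" for x
    using st by (auto simp: pivot_def)
  have "clearable K f t {x. f s < f x}"
    unfolding clearable_def using V t Rx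
    by (intro exI[of _ "\<lambda>z. V z t"]) (force simp: unit_upper_triangular_def R_eq[symmetric])
  moreover have "\<not> clearable K f t {x. f s \<le> f x}"
  proof
    assume "clearable K f t {x. f s \<le> f x}"
    then obtain w where w: "w t = 1" "\<And>z. z \<in> cells K \<Longrightarrow> f t < f z \<Longrightarrow> w z = 0"
      "\<And>x. x \<in> cells K \<Longrightarrow> f s \<le> f x \<Longrightarrow> chain_boundary K w x = 0"
      unfolding clearable_def by blast
    have inj: "inj_on f (cells K)" using filter_inj[OF K] by (auto intro: inj_onI)
    obtain c where c: "c t = w t"
      "\<And>z. z \<in> cells K \<Longrightarrow> w z = (\<Sum>y\<in>cells K. c y * V z y)"
      using unitriangular_expansion[of "cells K" f V t w, OF finite_cells[OF K] inj V t] w(2) by blast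
    have bw: "chain_boundary K w x = (\<Sum>y\<in>cells K. c y * R x y)" for x
      using chain_boundary_cong[of K w "\<lambda>z. \<Sum>y\<in>cells K. c y * V z y"] c(2)
      by (simp add: chain_boundary_sum R_eq)
    \<comment> \<open>The lowest of the pivots that occur in the combination survives, as pivots are distinct.\<close>
    have ex: "\<exists>y\<in>cells K. c y \<noteq> 0 \<and> R s y \<noteq> 0"
      using t c(1) w(1) Rst by (intro bexI[of _ t]) auto
    then obtain m where m: "m \<in> cells K" "\<exists>y\<in>cells K. c y \<noteq> 0 \<and> R m y \<noteq> 0"
      "\<And>x. x \<in> cells K \<Longrightarrow> \<exists>y\<in>cells K. c y \<noteq> 0 \<and> R x y \<noteq> 0 \<Longrightarrow> f x \<le> f m"
      using exists_lowest[OF K s, of "\<lambda>x. \<exists>y\<in>cells K. c y \<noteq> 0 \<and> R x y \<noteq> 0"] by blast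
    obtain y where y: "y \<in> cells K" "c y \<noteq> 0" "R m y \<noteq> 0" using m(2) by blast
    have piv: "pivot (cells K) f R m y'" if "y' \<in> cells K" "c y' \<noteq> 0" "R m y' \<noteq> 0" for y'
      using that m(1,3) by (auto simp: pivot_def)
    have "c y' * R m y' = 0" if "y' \<in> cells K - {y}" for y'
      using piv[of y'] piv[OF y] uniq[of m y y'] that by auto
    then have "chain_boundary K w m = c y * R m y"
      unfolding bw using sum.remove[OF finite_cells[OF K] y(1), of "\<lambda>y. c y * R m y"]
      by (simp del: mult_eq_0_iff)
    moreover have "f s \<le> f m" using m(3)[OF s ex] .
    ultimately show False using w(3)[OF m(1)] y by simp
  qed
  ultimately show ?thesis using s t by (simp add: min_low_pairs_def)
qed

text \<open>
  Choose each column of \<open>V\<close> as a chain whose boundary has the earliest possible pivot. If two columns had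
  the same pivot, subtracting a multiple of the first from the second would improve the second.
\<close>

lemma reduced_form_exists:
  assumes K: "filtered_lefschetz K f"
  shows "\<exists>R. reduced_form (cells K) f (boundary_matrix K) R \<and>
             (\<forall>(s, t)\<in>min_low_pairs K f. pivot (cells K) f R s t)"
proof -
  define lead where "lead = (\<lambda>t v. v t = (1::'b) \<and> (\<forall>z\<in>cells K. f t < f z \<longrightarrow> v z = 0))"
  \<comment> \<open>The size of this initial segment of cells measures the position of the lowest non-zero coefficient of the boundary.\<close>
  define bounds where "bounds = (\<lambda>v. {x \<in> cells K. \<exists>y\<in>cells K. f x \<le> f y \<and> chain_boundary K v y \<noteq> 0})"
  define V where "V = (\<lambda>z t. (ARG_MIN (\<lambda>v. card (bounds v)) v. lead t v) z)"
  define R where "R = mat_mult (cells K) (boundary_matrix K) V"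
  have R_eq: "R x y = chain_boundary K (\<lambda>z. V z y) x" for x y
    by (simp add: R_def mat_mult_boundary_matrix)
  have lead1: "lead t (\<lambda>z. if z = t then 1 else 0)" for t by (auto simp: lead_def)
  have leadV: "lead t (\<lambda>z. V z t)" and minV: "lead t w \<Longrightarrow> card (bounds (\<lambda>z. V z t)) \<le> card (bounds w)" for t w
    unfolding V_def using arg_min_nat_lemma[of "lead t" _ "\<lambda>v. card (bounds v)", OF lead1] by auto
  have fin: "finite (bounds v)" for v using finite_cells[OF K] by (simp add: bounds_def)
  \<comment> \<open>The chain \<open>V\<close> of \<open>t\<close> is at least as good as any competitor.\<close>
  have best: "R x t = 0" if w: "lead t w" "\<And>x. x \<in> cells K \<Longrightarrow> f s \<le> f x \<Longrightarrow> chain_boundary K w x = 0"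
    and s: "s \<in> cells K" and x: "x \<in> cells K" "f s \<le> f x" for w s x t
  proof (rule ccontr)
    assume "R x t \<noteq> 0"
    then have sub: "{y \<in> cells K. f y \<le> f s} \<subseteq> bounds (\<lambda>z. V z t)"
      using x by (auto simp: bounds_def R_eq intro!: bexI[of _ x])
    have "bounds w \<subseteq> {y \<in> cells K. f y < f s}"
      using w(2) unfolding bounds_def by force
    then have "bounds w \<subset> {y \<in> cells K. f y \<le> f s}" using s by force
    then have "bounds w \<subset> bounds (\<lambda>z. V z t)" using sub by blast
    then have "card (bounds w) < card (bounds (\<lambda>z. V z t))" using fin by (intro psubset_card_mono)
    then show False using minV[OF w(1)] by simp
  qed
  have "unit_upper_triangular (cells K) f V"
    using leadV by (auto simp: unit_upper_triangular_def lead_def)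
  moreover have distinct: "\<not> f t < f t'" if "pivot (cells K) f R s t" "pivot (cells K) f R s t'" for s t t'
  proof
    assume less: "f t < f t'"
    note piv = that[unfolded pivot_def]
    let ?a = "R s t' / R s t"
    define w where "w = (\<lambda>z. V z t' - ?a * V z t)"
    have bw: "chain_boundary K w x = R x t' - ?a * R x t" for x
      unfolding w_def R_eq by (rule chain_boundary_diff)
    have "lead t' w"
      using leadV[of t] leadV[of t'] less piv by (auto simp: lead_def w_def)
    moreover have "chain_boundary K w x = 0" if "x \<in> cells K" "f s \<le> f x" for x
    proof (cases "x = s")
      case True then show ?thesis using piv by (simp add: bw)
    next
      case False
      then have "f s < f x" using that filter_inj[OF K, of x s] piv by force
      then have "R x t = 0" "R x t' = 0" using piv that by force+
      then show ?thesis by (simp add: bw)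
    qed
    ultimately have "R s t' = 0" using best[of t' w s s] piv by simp
    then show False using piv by simp
  qed
  moreover have "t = t'" if "pivot (cells K) f R s t" "pivot (cells K) f R s t'" for s t t'
    using distinct[OF that] distinct[OF that(2,1)] filter_inj[OF K, of t t'] that by (auto simp: pivot_def)
  ultimately have "reduced_form (cells K) f (boundary_matrix K) R"
    unfolding reduced_form_def R_def by blast
  moreover have "pivot (cells K) f R s t" if "(s, t) \<in> min_low_pairs K f" for s t
  proof -
    have s: "s \<in> cells K" and t: "t \<in> cells K" and yes: "clearable K f t {x. f s < f x}"
      and no: "\<not> clearable K f t {x. f s \<le> f x}"
      using that by (auto simp: min_low_pairs_def)
    have "\<exists>x\<in>cells K. f s \<le> f x \<and> R x t \<noteq> 0"
    proof (rule ccontr)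
      assume "\<not> ?thesis"
      then have "clearable K f t {x. f s \<le> f x}"
        using leadV[of t] unfolding clearable_def lead_def R_eq
        by (intro exI[of _ "\<lambda>z. V z t"]) simp
      then show False using no by simp
    qed
    then obtain x where x: "x \<in> cells K" "f s \<le> f x" "R x t \<noteq> 0" by blast
    have above: "R x t = 0" if x: "x \<in> cells K" "f s < f x" for x
    proof -
      obtain w where "lead t w" "\<And>x. x \<in> cells K \<Longrightarrow> f s < f x \<Longrightarrow> chain_boundary K w x = 0"
        using yes unfolding clearable_def lead_def by blast
      then show ?thesis using best[of t w x x] x by auto
    qed
    have "x = s" using above[of x] x filter_inj[OF K, of x s] s by force
    then show ?thesis using x above s t unfolding pivot_def by force
  qed
  ultimately show ?thesis by auto
qed

lemma BD_eq_min_low_pairs: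
  assumes K: "filtered_lefschetz K f"
  shows "BD K f = min_low_pairs K f"
proof
  show "BD K f \<subseteq> min_low_pairs K f"
    using reduced_form_pivot_min_low[OF K] by (auto simp: BD_def)
  show "min_low_pairs K f \<subseteq> BD K f"
    using reduced_form_exists[OF K] by (auto simp: BD_def)
qed

lemma BD_quotient:
  assumes K: "filtered_lefschetz K f" and p: "p \<in> SH K f"
  shows "BD K f = insert p (BD (quotient K p) f)"
  using min_low_pairs_quotient[OF K p] BD_eq_min_low_pairs[OF K]
    BD_eq_min_low_pairs[OF filtered_lefschetz_quotient[OF K p]] by simp

lemma BD_zero: "filtered_lefschetz K f \<Longrightarrow> (\<And>x y. \<not> facet K x y) \<Longrightarrow> BD K f = {}"
  by (simp add: BD_eq_min_low_pairs min_low_pairs_zero)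

section \<open>Birth-death pairs as the pairs of a maximal sequence of cancellations\<close>

lemma lowest_pair_shallow:
  assumes K: "filtered_lefschetz K f" and "s \<in> cells K" "t \<in> cells K" "inc K t s \<noteq> 0"
    and s: "\<And>x y. facet K x y \<Longrightarrow> f x \<le> f s"
    and t: "\<And>y. y \<in> cells K \<Longrightarrow> inc K y s \<noteq> 0 \<Longrightarrow> f t \<le> f y"
  shows "(s, t) \<in> SH K f"
  using assms unfolding SH_def facet_def by blast

lemma lowest_shallow_pair_exists:
  assumes K: "filtered_lefschetz K f" and "facet K x y"
  obtains s t where "(s, t) \<in> SH K f" "\<And>a b. facet K a b \<Longrightarrow> f a \<le> f s"
proof -
  have xy: "x \<in> cells K" "y \<in> cells K" "inc K y x \<noteq> 0" using assms(2) by (auto simp: facet_def)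
  have fin: "finite (cells K)" by (rule finite_cells[OF K])
  obtain s where s: "s \<in> cells K" "\<exists>b. facet K s b"
    "\<And>a. a \<in> cells K \<Longrightarrow> \<exists>b. facet K a b \<Longrightarrow> f a \<le> f s"
    using exists_lowest[OF K xy(1), of "\<lambda>a. \<exists>b. facet K a b"] assms(2) by blast
  let ?T = "{b \<in> cells K. inc K b s \<noteq> 0}"
  have T: "finite ?T" "?T \<noteq> {}" using fin s(2) by (auto simp: facet_def)
  have "(s, arg_min_on f ?T) \<in> SH K f"
    using arg_min_if_finite[OF T, of f] s by (intro lowest_pair_shallow[OF K]) (auto simp: facet_def not_less)
  moreover have "f a \<le> f s" if "facet K a b" for a b
    using s(3)[of a] that by (auto simp: facet_def)
  ultimately show thesis using that by blast
qed

lemma BD_cancel: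
  "filtered_lefschetz K f \<Longrightarrow> shallow_seq K f ps \<Longrightarrow> BD K f = set ps \<union> BD (cancel K ps) f"
proof (induction ps arbitrary: K)
  case (Cons p ps)
  then show ?case
    using BD_quotient[OF Cons.prems(1), of p] Cons.IH[OF filtered_lefschetz_quotient[OF Cons.prems(1), of p]]
    by auto
qed simp

text \<open>
  A non-zero boundary matrix always has a shallow pair, namely the one that DEATH selects.
\<close>

lemma maximal_shallow_seq_exists:
  "filtered_lefschetz K f \<Longrightarrow> \<exists>ps. shallow_seq K f ps \<and> set ps = BD K f"
proof (induction "card (cells K)" arbitrary: K rule: less_induct)
  case less
  show ?case
  proof (cases "\<exists>x y. facet K x y")
    case True
    then obtain s t where st: "(s, t) \<in> SH K f"
      using lowest_shallow_pair_exists[OF less.prems] by metis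
    let ?Q = "quotient K (s, t)"
    have "card (cells ?Q) < card (cells K)"
      using finite_cells[OF less.prems] shallow_pairD[OF less.prems st] by (intro psubset_card_mono) auto
    then obtain ps where "shallow_seq ?Q f ps" "set ps = BD ?Q f"
      using less.hyps filtered_lefschetz_quotient[OF less.prems st] by blast
    then show ?thesis
      using st BD_quotient[OF less.prems st] by (intro exI[of _ "(s, t) # ps"]) auto
  next
    case False
    then show ?thesis using BD_zero[OF less.prems] by (intro exI[of _ "[]"]) auto
  qed
qed

lemma BD_cells:
  "filtered_lefschetz K f \<Longrightarrow> p \<in> BD K f \<Longrightarrow> fst p \<in> cells K \<and> snd p \<in> cells K \<and> f (fst p) < f (snd p)"
  using maximal_shallow_seq_exists shallow_seq_cells by blast

lemma BD_disjoint:
  "filtered_lefschetz K f \<Longrightarrow> p \<in> BD K f \<Longrightarrow> q \<in> BD K f \<Longrightarrow> p \<noteq> q \<Longrightarrow>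
     {fst p, snd p} \<inter> {fst q, snd q} = {}"
  using maximal_shallow_seq_exists shallow_seq_distinct(2) by metis

lemma BD_birth_inj:
  "filtered_lefschetz K f \<Longrightarrow> p \<in> BD K f \<Longrightarrow> q \<in> BD K f \<Longrightarrow> f (fst p) = f (fst q) \<Longrightarrow> p = q"
  using BD_disjoint[of K f p q] BD_cells[of K f] filter_inj[of K f "fst p" "fst q"] by auto

lemma shallow_seq_subset_BD:
  "filtered_lefschetz K f \<Longrightarrow> shallow_seq K f ps \<Longrightarrow> set ps \<subseteq> BD K f"
  using BD_cancel by blast

lemma BD_remaining:
  assumes K: "filtered_lefschetz K f" and ps: "shallow_seq K f ps"
  shows "BD (cancel K ps) f = BD K f - set ps"
proof -
  have "p \<notin> set ps" if "p \<in> BD (cancel K ps) f" for p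
    using BD_cells[OF filtered_lefschetz_cancel[OF K ps] that] by (auto simp: cells_cancel)
  then show ?thesis using BD_cancel[OF K ps] by blast
qed

lemma filter_sorted_split:
  assumes "sorted (map (birth_key f) ps)"
  shows "filter (\<lambda>p. m < f (fst p)) ps @ filter (\<lambda>p. f (fst p) \<le> m) ps = ps"
  using assms
proof (induction ps)
  case (Cons p ps)
  show ?case
  proof (cases "m < f (fst p)")
    case False
    then have "\<forall>q\<in>set (p # ps). f (fst q) \<le> m" using Cons.prems by force
    then have "filter (\<lambda>p. m < f (fst p)) (p # ps) = []"
      "filter (\<lambda>p. f (fst p) \<le> m) (p # ps) = p # ps"
      by (auto simp only: filter_empty_conv filter_id_conv)
    then show ?thesis by simp
  qed (use Cons in auto)
qed simp

text \<open>
  Reordering so that the pairs with birth after a threshold \<open>m\<close> come first. The sequence \<open>qs\<close> reaches the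
  stage at which row \<open>m\<close> has its final form, and \<open>rs\<close> does not affect this row.
\<close>

lemma shallow_seq_late_births_first:
  assumes K: "filtered_lefschetz K f" and ps: "shallow_seq K f ps"
  obtains qs rs where "shallow_seq K f (qs @ rs)" "cancel K (qs @ rs) = cancel K ps"
    "set qs = {p \<in> set ps. m < f (fst p)}" "set rs = {p \<in> set ps. f (fst p) \<le> m}"
    "sorted (map (birth_key f) (qs @ rs))"
proof -
  let ?ms = "sort_key (birth_key f) ps"
  have "sorted (map (birth_key f) ?ms)" by simp
  note split = filter_sorted_split[OF this, of m]
  show thesis
    by (rule that[of "filter (\<lambda>p. m < f (fst p)) ?ms" "filter (\<lambda>p. f (fst p) \<le> m) ?ms"])
      (use shallow_seq_sort[OF K ps] in \<open>auto simp only: split set_filter set_sort sorted_sort_key\<close>)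
qed

section \<open>The relation computed by DEATH\<close>

lemma row_unaffected:
  assumes "filtered_lefschetz K f" "shallow_seq K f qs" "\<And>q. q \<in> set qs \<Longrightarrow> f (fst q) < f x"
    and "x \<in> cells (cancel K qs)"
  shows "inc (cancel K qs) y x = inc K y x"
  using assms
proof (induction qs arbitrary: K)
  case (Cons q qs)
  obtain s t where [simp]: "q = (s, t)" by (cases q)
  have "x \<in> cells K" using Cons.prems(4) by (auto simp: cells_cancel)
  then have "inc K t x = 0"
    using shallow_pairD(6)[OF Cons.prems(1), of s t x] Cons.prems(2) Cons.prems(3)[of q] by force
  then show ?case
    using Cons.IH[OF filtered_lefschetz_quotient[OF Cons.prems(1), of q]] Cons.prems by simp
qed simp

lemma column_unaffected:
  assumes "\<And>q. q \<in> set qs \<Longrightarrow> inc K y (fst q) = 0"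
  shows "inc (cancel K qs) y x = inc K y x"
  using assms
proof (induction qs arbitrary: K)
  case (Cons q qs)
  obtain s t where [simp]: "q = (s, t)" by (cases q)
  have "inc (quotient K q) y z = inc K y z" for z using Cons.prems[of q] by simp
  then show ?case using Cons.IH[of "quotient K q"] Cons.prems by simp
qed simp

text \<open>
  The links of DEATH without reference to a run of the algorithm. Any sequence \<open>us\<close> of cancellations of
  the pairs with birth after \<open>fst p\<close> may be taken, since they all give the same quotient.
\<close>

definition death_rel ::
  "('a, 'k::field) lefschetz \<Rightarrow> ('a \<Rightarrow> real) \<Rightarrow> (('a \<times> 'a) \<times> ('a \<times> 'a)) set" where
  "death_rel K f = {(p, q). p \<in> BD K f \<and> q \<in> BD K f \<and> f (fst q) < f (fst p) \<and>
     (\<exists>us. shallow_seq K f us \<and> set us = {r \<in> BD K f. f (fst p) < f (fst r)} \<and>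
           inc (cancel K us) (snd q) (fst p) \<noteq> 0)}"

text \<open>
  After sorting \<open>ps\<close> by descending birth, the pairs in \<open>us\<close> come first. The remaining ones have births
  before \<open>x\<close> and leave row \<open>x\<close> unchanged.
\<close>

lemma stage_row:
  assumes K: "filtered_lefschetz K f" and us: "shallow_seq K f us"
    and set_us: "set us = {r \<in> BD K f. f x < f (fst r)}"
    and ps: "shallow_seq K f ps" and sub: "set us \<subseteq> set ps" and x: "x \<in> cells (cancel K ps)"
  shows "inc (cancel K ps) y x = inc (cancel K us) y x"
proof -
  obtain qs rs where qr: "shallow_seq K f (qs @ rs)" "cancel K (qs @ rs) = cancel K ps"
    "set qs = {p \<in> set ps. f x < f (fst p)}" "set rs = {p \<in> set ps. f (fst p) \<le> f x}"
    by (rule shallow_seq_late_births_first[OF K ps, of "f x"]) blast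
  have "set qs = set us" using qr(3) set_us sub shallow_seq_subset_BD[OF K ps] by auto
  then have eq: "cancel K qs = cancel K us" using cancel_cong_set[OF K _ us] qr(1) by simp
  have "f (fst r) < f x" if r: "r \<in> set rs" for r
  proof -
    have "fst r \<noteq> x" using x r qr(4) by (auto simp: cells_cancel)
    then have "f (fst r) \<noteq> f x"
      using filter_inj[OF K] shallow_seq_cells[OF K ps, of r] r qr(4) x by (auto simp: cells_cancel)
    then show ?thesis using r qr(4) by auto
  qed
  then have "inc (cancel (cancel K qs) rs) y x = inc (cancel K qs) y x"
    using qr(1,2) x filtered_lefschetz_cancel[OF K, of qs] by (intro row_unaffected) auto
  then show ?thesis using qr(2) eq by simp
qed

text \<open>
  When \<open>q\<close> is shallow, its column vanishes below \<open>fst q\<close>. Cancelling the remaining pairs with birth after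
  \<open>fst p\<close> does not change this column, because its entries in the rows of these births are zero, and leads to
  the entry that decides about the link.
\<close>

lemma death_rel_respected:
  assumes K: "filtered_lefschetz K f" and \<Phi>: "shallow_seq K f (us @ q # vs)"
    and BD: "set (us @ q # vs) = BD K f" and p: "p \<in> set vs"
  shows "(p, q) \<notin> death_rel K f"
proof
  assume "(p, q) \<in> death_rel K f"
  then obtain ws where later: "f (fst q) < f (fst p)" and ws: "shallow_seq K f ws"
    "set ws = {r \<in> BD K f. f (fst p) < f (fst r)}" "inc (cancel K ws) (snd q) (fst p) \<noteq> 0"
    by (auto simp: death_rel_def)
  let ?K1 = "cancel K us"
  have K1: "filtered_lefschetz ?K1 f" and seq1: "shallow_seq ?K1 f (q # vs)"
    using \<Phi> filtered_lefschetz_cancel[OF K] by auto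
  have q: "(fst q, snd q) \<in> SH ?K1 f" using seq1 by simp
  have pq: "p \<noteq> q" using later by auto
  obtain qs rs where qr: "shallow_seq ?K1 f (qs @ rs)"
    "set qs = {r \<in> set (q # vs). f (fst p) < f (fst r)}"
    by (rule shallow_seq_late_births_first[OF K1 seq1, of "f (fst p)"]) blast
  have zero: "inc ?K1 (snd q) (fst r) = 0" if "r \<in> set (q # vs)" "f (fst p) \<le> f (fst r)" for r
    using shallow_pairD(6)[OF K1 q, of "fst r"] shallow_seq_cells[OF K1 seq1 that(1)] that(2) later by force
  have "inc (cancel ?K1 qs) (snd q) (fst p) = inc ?K1 (snd q) (fst p)"
    by (rule column_unaffected) (use zero qr(2) in auto)
  then have "inc (cancel K (us @ qs)) (snd q) (fst p) = 0" using zero[of p] p by simp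
  moreover have "fst p \<in> cells (cancel K (us @ qs))"
    using shallow_seq_uncancelled[OF K1 seq1, of p qs] p qr(2) by auto
  moreover have "shallow_seq K f (us @ qs)" using \<Phi> qr(1) by simp
  moreover have "set ws \<subseteq> set (us @ qs)" using ws(2) qr(2) BD by auto
  ultimately show False using stage_row[OF K ws(1,2), of "us @ qs" "snd q"] ws(3) by simp
qed

text \<open>
  Suppose column \<open>snd p\<close> has a non-zero entry below \<open>fst p\<close>, the lowest one in row \<open>m\<close>. This entry survives
  the cancellation of all remaining pairs with birth after \<open>m\<close>. Then no birth after \<open>m\<close> is left, so the lowest
  non-zero row is \<open>m\<close>, and \<open>m\<close> is the birth of an uncancelled pair that has a link to \<open>p\<close>. The same argument
  with \<open>m = fst p\<close> shows that the entry of \<open>p\<close> itself is non-zero.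
\<close>

lemma column_clear_if_predecessors_cancelled:
  assumes K: "filtered_lefschetz K f" and us: "shallow_seq K f us" and p: "p \<in> BD K f - set us"
    and pred: "\<And>r. (r, p) \<in> death_rel K f \<Longrightarrow> r \<in> set us"
  shows "facet (cancel K us) x (snd p) \<Longrightarrow> f x \<le> f (fst p)"
    and "inc (cancel K us) (snd p) (fst p) \<noteq> 0"
proof -
  let ?K1 = "cancel K us"
  have K1: "filtered_lefschetz ?K1 f" by (rule filtered_lefschetz_cancel[OF K us])
  have p1: "p \<in> BD ?K1 f" using p BD_remaining[OF K us] by simp
  note p_cells = BD_cells[OF K1 p1]
  obtain ds where ds: "shallow_seq ?K1 f ds" "set ds = BD ?K1 f"
    using maximal_shallow_seq_exists[OF K1] by blast
  show below: "f x \<le> f (fst p)" if "facet ?K1 x (snd p)" for x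
  proof (rule ccontr)
    assume "\<not> f x \<le> f (fst p)"
    then have "x \<in> cells ?K1" "f (fst p) < f x \<and> inc ?K1 (snd p) x \<noteq> 0"
      using that by (auto simp: facet_def)
    then obtain m where m: "m \<in> cells ?K1" "f (fst p) < f m" "inc ?K1 (snd p) m \<noteq> 0"
      "\<And>x. x \<in> cells ?K1 \<Longrightarrow> f (fst p) < f x \<Longrightarrow> inc ?K1 (snd p) x \<noteq> 0 \<Longrightarrow> f x \<le> f m"
      using exists_lowest[OF K1, of x "\<lambda>x. f (fst p) < f x \<and> inc ?K1 (snd p) x \<noteq> 0"] by blast
    obtain qs rs where qr: "shallow_seq ?K1 f (qs @ rs)"
      "set qs = {r \<in> set ds. f m < f (fst r)}"
      by (rule shallow_seq_late_births_first[OF K1 ds(1), of "f m"]) blast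
    let ?K2 = "cancel ?K1 qs"
    have K2: "filtered_lefschetz ?K2 f" using filtered_lefschetz_cancel[OF K1, of qs] qr(1) by simp
    have qs_cells: "fst r \<in> cells ?K1 \<and> f (fst r) < f (snd r)" if "r \<in> set qs" for r
      using BD_cells[OF K1, of r] that qr(2) ds(2) by auto
    have col: "inc ?K2 (snd p) y = inc ?K1 (snd p) y" for y
      by (rule column_unaffected) (use m(2,4) qr(2) qs_cells in force)
    have m2: "m \<in> cells ?K2"
      using m(1) qr(2) qs_cells by (fastforce simp: cells_cancel[of ?K1])
    have p2: "p \<notin> set qs" using m(2) qr(2) by auto
    have BD2: "BD ?K2 f = BD ?K1 f - set qs" using BD_remaining[OF K1, of qs] qr(1) by simp
    have "snd p \<in> cells ?K2" using BD_cells[OF K2, of p] BD2 p1 p2 by auto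
    then have "facet ?K2 m (snd p)" using m(3) m2 col by (simp add: facet_def)
    then obtain s t where st: "(s, t) \<in> SH ?K2 f" "f m \<le> f s"
      using lowest_shallow_pair_exists[OF K2] by metis
    have st_BD: "(s, t) \<in> BD ?K2 f" using BD_quotient[OF K2 st(1)] by simp
    then have "f s \<le> f m" using BD2 qr(2) ds(2) by auto
    then have [simp]: "s = m" using filter_inj[OF K2, of s m] st(2) m2 BD_cells[OF K2 st_BD] by auto
    have st_BD_K: "(m, t) \<in> BD K f" "(m, t) \<notin> set us" using st_BD BD2 BD_remaining[OF K us] by auto
    obtain es where es: "shallow_seq K f es" "set es = BD K f"
      using maximal_shallow_seq_exists[OF K] by blast
    obtain ws rs where ws: "shallow_seq K f (ws @ rs)" "set ws = {r \<in> BD K f. f m < f (fst r)}"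
      by (rule shallow_seq_late_births_first[OF K es(1), of "f m"]) (use es(2) in blast)
    have "set ws \<subseteq> set (us @ qs)" using ws(2) qr(2) ds(2) BD_remaining[OF K us] by auto
    then have "inc (cancel K ws) (snd p) m \<noteq> 0"
      using stage_row[OF K _ ws(2), of "us @ qs" "snd p"] ws(1) us qr(1) m2 m(3) col by simp
    then have "((m, t), p) \<in> death_rel K f"
      unfolding death_rel_def using ws m(2) p st_BD_K by auto
    then show False using pred st_BD_K(2) by blast
  qed
  obtain qs rs where qr: "shallow_seq ?K1 f (qs @ rs)" 
      "set qs = {r \<in> set ds. f (fst p) < f (fst r)}" "set rs = {r \<in> set ds. f (fst r) \<le> f (fst p)}"
      "sorted (map (birth_key f) (qs @ rs))"
    by (rule shallow_seq_late_births_first[OF K1 ds(1), of "f (fst p)"]) blast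
  have p_rs: "p \<in> set rs" using qr(3) p1 ds(2) by simp
  obtain r rs' where rs: "rs = r # rs'" using p_rs by (cases rs) auto
  \<comment> \<open>\<open>p\<close> has the latest birth in \<open>rs\<close>.\<close>
  have "r = p"
  proof -
    have "r \<in> set rs" using rs by simp
    moreover have "f (fst p) \<le> f (fst r)" using qr(4) p_rs rs by (auto simp: sorted_append)
    ultimately show ?thesis using BD_birth_inj[OF K1, of r p] qr(3) ds(2) p1 by auto
  qed
  then have "(fst p, snd p) \<in> SH (cancel ?K1 qs) f" using qr(1) rs by simp
  then have "inc (cancel ?K1 qs) (snd p) (fst p) \<noteq> 0"
    using shallow_pairD(3)[OF filtered_lefschetz_cancel[OF K1, of qs]] qr(1) by simp
  moreover have "inc ?K1 (snd p) (fst r) = 0" if "r \<in> set qs" for r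
    using below[of "fst r"] that qr(2) ds(2) BD_cells[OF K1, of r] p_cells by (force simp: facet_def)
  ultimately show "inc ?K1 (snd p) (fst p) \<noteq> 0"
    using column_unaffected[of qs ?K1 "snd p" "fst p"] by simp
qed

section \<open>Duality and the relation computed by BIRTH\<close>

definition dual :: "('a, 'k::field) lefschetz \<Rightarrow> ('a, 'k) lefschetz" where
  "dual K = \<lparr>cells = cells K, cdim = (\<lambda>x. - cdim K x), inc = (\<lambda>y x. inc K x y)\<rparr>"

lemma dual_simps [simp]:
  "cells (dual K) = cells K" "cdim (dual K) x = - cdim K x" "inc (dual K) y x = inc K x y"
  by (simp_all add: dual_def)

lemma dual_dual [simp]: "dual (dual K) = K"
  by (simp add: dual_def)

lemma facet_dual [simp]: "facet (dual K) x y \<longleftrightarrow> facet K y x"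
  by (auto simp: facet_def)

lemma filtered_lefschetz_dual:
  assumes K: "filtered_lefschetz K f"
  shows "filtered_lefschetz (dual K) (\<lambda>x. - f x)"
  using K
  by (auto simp: filtered_lefschetz_def lefschetz_complex_def filter_on_def inj_on_def mult.commute)

lemma SH_dual: "prod.swap p \<in> SH (dual K) (\<lambda>x. - f x) \<longleftrightarrow> p \<in> SH K f"
  by (cases p) (auto simp: SH_def)

lemma quotient_dual: "quotient (dual K) (prod.swap p) = dual (quotient K p)"
  by (cases p) (auto intro!: lefschetz.equality simp: fun_eq_iff)

lemma cancel_dual: "cancel (dual K) (map prod.swap ps) = dual (cancel K ps)"
  by (induction ps arbitrary: K) (auto simp: quotient_dual)

lemma shallow_seq_dual:
  "shallow_seq (dual K) (\<lambda>x. - f x) (map prod.swap ps) \<longleftrightarrow> shallow_seq K f ps"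
  by (induction ps arbitrary: K) (auto simp: quotient_dual SH_dual)

text \<open>
  A maximal sequence of cancellations for a complex is one for its dual, with the cells in each pair exchanged.
\<close>

lemma BD_dual:
  assumes K: "filtered_lefschetz K f"
  shows "BD (dual K) (\<lambda>x. - f x) = prod.swap ` BD K f"
proof -
  have sub: "prod.swap ` BD K f \<subseteq> BD (dual K) (\<lambda>x. - f x)"
    if K: "filtered_lefschetz K f" for K :: "('a, 'b) lefschetz" and f
  proof -
    obtain ps where ps: "shallow_seq K f ps" "set ps = BD K f"
      using maximal_shallow_seq_exists[OF K] by blast
    have "set (map prod.swap ps) \<subseteq> BD (dual K) (\<lambda>x. - f x)"
      using filtered_lefschetz_dual[OF K] by (rule shallow_seq_subset_BD) (simp only: shallow_seq_dual ps)
    then show ?thesis using ps by simp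
  qed
  have "prod.swap ` BD (dual K) (\<lambda>x. - f x) \<subseteq> BD K f"
    using sub[OF filtered_lefschetz_dual[OF K]] by simp
  then have "prod.swap ` prod.swap ` BD (dual K) (\<lambda>x. - f x) \<subseteq> prod.swap ` BD K f"
    by (rule image_mono)
  then show ?thesis using sub[OF K] by (simp add: image_image)
qed

text \<open>
  The links of BIRTH, which works on the transposed matrix in reverse order exactly as DEATH does.
\<close>

definition birth_rel ::
  "('a, 'k::field) lefschetz \<Rightarrow> ('a \<Rightarrow> real) \<Rightarrow> (('a \<times> 'a) \<times> ('a \<times> 'a)) set" where
  "birth_rel K f = {(p, q). (prod.swap p, prod.swap q) \<in> death_rel (dual K) (\<lambda>x. - f x)}"

lemma death_rel_D:
  "(p, q) \<in> death_rel K f \<Longrightarrow> p \<in> BD K f \<and> q \<in> BD K f \<and> p \<noteq> q"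
  by (auto simp: death_rel_def)

lemma birth_rel_D:
  assumes K: "filtered_lefschetz K f" and "(p, q) \<in> birth_rel K f"
  shows "p \<in> BD K f \<and> q \<in> BD K f \<and> p \<noteq> q"
  using assms death_rel_D[of "prod.swap p" "prod.swap q" "dual K" "\<lambda>x. - f x"]
  by (cases p, cases q) (auto simp: birth_rel_def BD_dual[OF K])

lemma birth_rel_respected:
  assumes K: "filtered_lefschetz K f" and \<Phi>: "shallow_seq K f (us @ q # vs)"
    and BD: "set (us @ q # vs) = BD K f" and p: "p \<in> set vs"
  shows "(p, q) \<notin> birth_rel K f"
proof -
  let ?us = "map prod.swap us" and ?vs = "map prod.swap vs"
  have "shallow_seq (dual K) (\<lambda>x. - f x) (map prod.swap (us @ q # vs))"
    using \<Phi> by (simp only: shallow_seq_dual)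
  moreover have "set (map prod.swap (us @ q # vs)) = BD (dual K) (\<lambda>x. - f x)"
    unfolding BD_dual[OF K] BD[symmetric] by (simp only: set_map)
  ultimately have "(prod.swap p, prod.swap q) \<notin> death_rel (dual K) (\<lambda>x. - f x)"
    using p by (intro death_rel_respected[OF filtered_lefschetz_dual[OF K], of ?us _ ?vs]) auto
  then show ?thesis by (simp add: birth_rel_def)
qed

lemma row_clear_if_predecessors_cancelled:
  assumes K: "filtered_lefschetz K f" and us: "shallow_seq K f us" and p: "p \<in> BD K f - set us"
    and pred: "\<And>r. (r, p) \<in> birth_rel K f \<Longrightarrow> r \<in> set us"
    and y: "facet (cancel K us) (fst p) y"
  shows "f (snd p) \<le> f y"
proof -
  note K' = filtered_lefschetz_dual[OF K]
  let ?us = "map prod.swap us"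
  have us': "shallow_seq (dual K) (\<lambda>x. - f x) ?us" using us by (simp only: shallow_seq_dual)
  have p': "prod.swap p \<in> BD (dual K) (\<lambda>x. - f x) - set ?us"
    using p by (cases p) (auto simp: BD_dual[OF K])
  have pred': "r \<in> set ?us" if "(r, prod.swap p) \<in> death_rel (dual K) (\<lambda>x. - f x)" for r
    using pred[of "prod.swap r"] that by (force simp: birth_rel_def image_iff)
  show ?thesis
    using column_clear_if_predecessors_cancelled(1)[OF K' us' p' pred', of y] y
    by (simp add: cancel_dual)
qed

lemma shallow_if_predecessors_cancelled:
  assumes K: "filtered_lefschetz K f" and us: "shallow_seq K f us" and p: "p \<in> BD K f - set us"
    and pred: "\<And>r. (r, p) \<in> death_rel K f \<union> birth_rel K f \<Longrightarrow> r \<in> set us"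
  shows "p \<in> SH (cancel K us) f"
proof -
  have "p \<in> BD (cancel K us) f" using p BD_remaining[OF K us] by simp
  then have "fst p \<in> cells (cancel K us)" "snd p \<in> cells (cancel K us)"
    using BD_cells[OF filtered_lefschetz_cancel[OF K us]] by auto
  moreover have "inc (cancel K us) (snd p) (fst p) \<noteq> 0"
    and "\<And>x. facet (cancel K us) x (snd p) \<Longrightarrow> f x \<le> f (fst p)"
    using column_clear_if_predecessors_cancelled[OF K us p] pred by blast+
  moreover have "\<And>y. facet (cancel K us) (fst p) y \<Longrightarrow> f (snd p) \<le> f y"
    using row_clear_if_predecessors_cancelled[OF K us p] pred by blast
  ultimately have "(fst p, snd p) \<in> SH (cancel K us) f"
    by (cases p) (auto simp: SH_def facet_def)
  then show ?thesis by simp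
qed

section \<open>Shallow orders as linear extensions\<close>

abbreviation link_rel ::
  "('a, 'k::field) lefschetz \<Rightarrow> ('a \<Rightarrow> real) \<Rightarrow> (('a \<times> 'a) \<times> ('a \<times> 'a)) set" where
  "link_rel K f \<equiv> death_rel K f \<union> birth_rel K f"

text \<open>
  Links are respected by every shallow order. Conversely, along a linear extension each pair comes after
  its predecessors, which is enough for it to be shallow at its turn.
\<close>

lemma shallow_order_iff_linear_extension:
  assumes K: "filtered_lefschetz K f"
  shows "shallow_order K f \<Phi> \<longleftrightarrow>
    distinct \<Phi> \<and> set \<Phi> = BD K f \<and> sorted_wrt (\<lambda>p q. (q, p) \<notin> link_rel K f) \<Phi>"
proof -
  have "shallow_seq K f \<Phi> \<longleftrightarrow> sorted_wrt (\<lambda>p q. (q, p) \<notin> link_rel K f) \<Phi>"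
    if \<Phi>: "distinct \<Phi>" "set \<Phi> = BD K f"
  proof
    assume seq: "shallow_seq K f \<Phi>"
    have "(\<Phi> ! j, \<Phi> ! i) \<notin> link_rel K f" if ij: "i < j" "j < length \<Phi>" for i j
    proof -
      have split: "take i \<Phi> @ \<Phi> ! i # drop (Suc i) \<Phi> = \<Phi>"
        using ij id_take_nth_drop[of i \<Phi>] by simp
      have "\<Phi> ! j \<in> set (drop (Suc i) \<Phi>)"
        using ij by (auto simp: in_set_conv_nth intro!: exI[of _ "j - Suc i"])
      then show ?thesis
        using death_rel_respected[OF K, of "take i \<Phi>" "\<Phi> ! i" "drop (Suc i) \<Phi>"]
          birth_rel_respected[OF K, of "take i \<Phi>" "\<Phi> ! i" "drop (Suc i) \<Phi>"] \<Phi>(2) seq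
        unfolding split by blast
    qed
    then show "sorted_wrt (\<lambda>p q. (q, p) \<notin> link_rel K f) \<Phi>" by (simp add: sorted_wrt_iff_nth_less)
  next
    assume sorted: "sorted_wrt (\<lambda>p q. (q, p) \<notin> link_rel K f) \<Phi>"
    have "shallow_seq K f us" if "\<Phi> = us @ vs" for us vs
      using that
    proof (induction us arbitrary: vs rule: rev_induct)
      case (snoc p us)
      have us: "shallow_seq K f us" by (rule snoc.IH[of "p # vs"]) (use snoc.prems in simp)
      have "r \<in> set us" if "(r, p) \<in> link_rel K f" for r
        using that sorted \<Phi>(2) death_rel_D[of r p K f] birth_rel_D[OF K, of r p]
        unfolding snoc.prems by (auto simp: sorted_wrt_append)
      moreover have "p \<in> BD K f - set us" using \<Phi> snoc.prems by auto
      ultimately show ?case using shallow_if_predecessors_cancelled[OF K us] us by simp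
    qed simp
    then show "shallow_seq K f \<Phi>" by simp
  qed
  then show ?thesis unfolding shallow_order_def shallow_seq_iff_nth by blast
qed

lemma sorted_wrt_rtrancl_list_order:
  assumes \<Phi>: "distinct \<Phi>" "sorted_wrt (\<lambda>p q. (q, p) \<notin> R) \<Phi>" and R: "R \<subseteq> set \<Phi> \<times> set \<Phi>"
    and p: "p \<in> set \<Phi>" and pq: "(p, q) \<in> R\<^sup>*"
  shows "(p, q) \<in> list_order \<Phi>"
  using pq
proof induction
  case base
  then show ?case using p by (auto simp: list_order_def in_set_conv_nth)
next
  case (step y z)
  obtain i j where ij: "p = \<Phi> ! i" "y = \<Phi> ! j" "i \<le> j" "j < length \<Phi>"
    using step.IH by (auto simp: list_order_def)
  have "z \<in> set \<Phi>" using step.hyps(2) R by auto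
  then obtain k where k: "z = \<Phi> ! k" "k < length \<Phi>"
    by (auto simp: in_set_conv_nth)
  have "\<not> k < j" using \<Phi>(2) ij(2,4) k step.hyps(2) by (auto simp: sorted_wrt_iff_nth_less)
  then show ?case using ij k unfolding list_order_def by force
qed

text \<open>
  Rearranging \<open>\<Phi>\<close> so that the down-set of \<open>q\<close> comes first keeps it a linear extension; since \<open>p\<close> is not in
  this down-set, it ends up behind \<open>q\<close>.
\<close>

lemma linear_extension_against:
  assumes \<Phi>: "distinct \<Phi>" "sorted_wrt (\<lambda>p q. (q, p) \<notin> R) \<Phi>" and R: "R \<subseteq> set \<Phi> \<times> set \<Phi>"
    and pq: "p \<in> set \<Phi>" "q \<in> set \<Phi>" "(p, q) \<notin> R\<^sup>*"
  shows "\<exists>\<Psi>. distinct \<Psi> \<and> set \<Psi> = set \<Phi> \<and> sorted_wrt (\<lambda>p q. (q, p) \<notin> R) \<Psi> \<and>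
    (p, q) \<notin> list_order \<Psi>"
proof -
  let ?U = "\<lambda>r. (r, q) \<in> R\<^sup>*"
  let ?us = "filter ?U \<Phi>" and ?vs = "filter (\<lambda>r. \<not> ?U r) \<Phi>"
  have against: "(p, q) \<notin> list_order (?us @ ?vs)"
  proof
    assume "(p, q) \<in> list_order (?us @ ?vs)"
    then obtain i j where ij: "p = (?us @ ?vs) ! i" "q = (?us @ ?vs) ! j" "i \<le> j"
      "j < length (?us @ ?vs)"
      by (auto simp: list_order_def)
    have "\<not> i < length ?us"
      using ij(1) pq(3) nth_mem[of i ?us] by (auto simp: nth_append)
    then have "q = ?vs ! (j - length ?us)" "j - length ?us < length ?vs"
      using ij(2-4) by (auto simp: nth_append)
    then have "q \<in> set ?vs" by (metis nth_mem)
    then show False by simp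
  qed
  moreover have "sorted_wrt (\<lambda>p q. (q, p) \<notin> R) (?us @ ?vs)"
    using \<Phi>(2) by (auto simp: sorted_wrt_append sorted_wrt_filter intro: converse_rtrancl_into_rtrancl)
  then show ?thesis
    using \<Phi>(1) against by (intro exI[of _ "?us @ ?vs"]) auto
qed

theorem depth_poset_eq_closure:
  assumes K: "filtered_lefschetz K f"
  shows "depth_poset K f = closure_on (BD K f) (link_rel K f)"
proof -
  have R: "link_rel K f \<subseteq> BD K f \<times> BD K f"
    using death_rel_D birth_rel_D[OF K] by fast
  obtain \<Phi>0 where "shallow_seq K f \<Phi>0" "set \<Phi>0 = BD K f"
    using maximal_shallow_seq_exists[OF K] by blast
  then have \<Phi>0: "shallow_order K f \<Phi>0"
    using shallow_seq_distinct(1)[OF K] by (auto simp: shallow_order_def shallow_seq_iff_nth)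
  have "(\<forall>\<Phi>. shallow_order K f \<Phi> \<longrightarrow> (p, q) \<in> list_order \<Phi>) \<longleftrightarrow> (p, q) \<in> (link_rel K f)\<^sup>*"
    if pq: "p \<in> BD K f" "q \<in> BD K f" for p q
  proof
    assume "(p, q) \<in> (link_rel K f)\<^sup>*"
    then show "\<forall>\<Phi>. shallow_order K f \<Phi> \<longrightarrow> (p, q) \<in> list_order \<Phi>"
      unfolding shallow_order_iff_linear_extension[OF K]
      using sorted_wrt_rtrancl_list_order R pq by metis
  next
    assume all: "\<forall>\<Phi>. shallow_order K f \<Phi> \<longrightarrow> (p, q) \<in> list_order \<Phi>"
    show "(p, q) \<in> (link_rel K f)\<^sup>*"
      using linear_extension_against[of \<Phi>0 "link_rel K f" p q] \<Phi>0 all R pq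
      unfolding shallow_order_iff_linear_extension[OF K] by metis
  qed
  then show ?thesis unfolding depth_poset_def closure_on_def by blast
qed

section \<open>Correctness of the algorithms\<close>

lemma arg_min_max_on_uminus:
  fixes f :: "'a \<Rightarrow> real"
  shows "arg_min_on (\<lambda>x. - f x) S = arg_max_on f S" "arg_max_on (\<lambda>x. - f x) S = arg_min_on f S"
  by (simp_all add: arg_min_on_def arg_max_on_def arg_min_def arg_max_def is_arg_min_def is_arg_max_def)

lemma arg_min_on_finite:
  fixes f :: "'a \<Rightarrow> real"
  assumes "finite S" "S \<noteq> {}"
  shows "arg_min_on f S \<in> S" "x \<in> S \<Longrightarrow> f (arg_min_on f S) \<le> f x"
  using arg_min_if_finite[OF assms, of f] by (auto simp: not_less)

lemma arg_max_on_finite: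
  fixes f :: "'a \<Rightarrow> real"
  assumes "finite S" "S \<noteq> {}"
  shows "arg_max_on f S \<in> S" "x \<in> S \<Longrightarrow> f x \<le> f (arg_max_on f S)"
  using arg_min_on_finite[OF assms, where f = "\<lambda>x. - f x"] by (auto simp: arg_min_max_on_uminus)

text \<open>
  The recorded list \<open>L\<close> if DEATH cancels the pairs \<open>ds\<close> in this order.
\<close>

definition death_links ::
  "('a, 'k::field) lefschetz \<Rightarrow> ('a \<times> 'a) list \<Rightarrow> ('a \<times> 'a) set" where
  "death_links K ds = {(snd (ds ! i), y) | i y. i < length ds \<and>
     y \<in> cells (cancel K (take (Suc i) ds)) \<and> inc (cancel K (take i ds)) y (fst (ds ! i)) \<noteq> 0}"

lemma death_links_snoc:
  "death_links K (ds @ [(s, t)]) = death_links K ds \<union>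
     {(t, y) | y. y \<in> cells (cancel K ds) - {s, t} \<and> inc (cancel K ds) y s \<noteq> 0}"
  unfolding death_links_def by (auto simp: less_Suc_eq nth_append)

text \<open>
  The current matrix is the boundary matrix of the quotient by the pairs found so far. That all non-zero rows
  lie before the births found so far keeps these in descending order.
\<close>

definition death_invariant ::
  "('a, 'k::field) lefschetz \<Rightarrow> ('a \<Rightarrow> real) \<Rightarrow> ('a \<times> 'a) list \<Rightarrow> ('a, 'k) state \<Rightarrow> bool" where
  "death_invariant K f ds = (\<lambda>(I, A, D, L).
     shallow_seq K f ds \<and> sorted_wrt (\<lambda>p q. f (fst q) < f (fst p)) ds \<and>
     (\<forall>a b. facet (cancel K ds) a b \<longrightarrow> (\<forall>d\<in>set ds. f a < f (fst d))) \<and>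
     I = cells (cancel K ds) \<and> (\<forall>x\<in>I. \<forall>y\<in>I. A x y = inc (cancel K ds) y x) \<and>
     D = set ds \<and> L = death_links K ds)"

text \<open>
  The pair selected by DEATH is the lowest shallow pair, and restricted to the remaining cells the column
  operations are the formula for the quotient: a column left unchanged has entry zero in row \<open>s\<close>.
\<close>

lemma death_invariant_step:
  assumes K: "filtered_lefschetz K f" and inv: "death_invariant K f ds S" and nz: "nonzero_state S"
  shows "\<exists>ds'. death_invariant K f ds' (death_step f S)"
    and "card (fst (death_step f S)) < card (fst S)"
proof -
  obtain I A D L where S: "S = (I, A, D, L)" by (cases S)
  let ?K1 = "cancel K ds"
  have ds: "shallow_seq K f ds" "sorted_wrt (\<lambda>p q. f (fst q) < f (fst p)) ds"
    and rows: "\<And>a b d. facet ?K1 a b \<Longrightarrow> d \<in> set ds \<Longrightarrow> f a < f (fst d)"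
    and I: "I = cells ?K1" and A: "\<And>x y. x \<in> I \<Longrightarrow> y \<in> I \<Longrightarrow> A x y = inc ?K1 y x"
    and D: "D = set ds" and L: "L = death_links K ds"
    using inv by (auto simp: S death_invariant_def)
  have K1: "filtered_lefschetz ?K1 f" by (rule filtered_lefschetz_cancel[OF K ds(1)])
  have fin: "finite I" using finite_cells[OF K1] I by simp
  define s where "s = arg_max_on f {x \<in> I. \<exists>y\<in>I. A x y \<noteq> 0}"
  define t where "t = arg_min_on f {y \<in> I. A s y \<noteq> 0}"
  define Y where "Y = {y \<in> I. f t < f y \<and> A s y \<noteq> 0}"
  have "finite {x \<in> I. \<exists>y\<in>I. A x y \<noteq> 0}" "{x \<in> I. \<exists>y\<in>I. A x y \<noteq> 0} \<noteq> {}"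
    using fin nz by (auto simp: nonzero_state_def S)
  note s = arg_max_on_finite[OF this, where f = f, folded s_def]
  have "finite {y \<in> I. A s y \<noteq> 0}" "{y \<in> I. A s y \<noteq> 0} \<noteq> {}" using fin s(1) by auto
  note t = arg_min_on_finite[OF this, where f = f, folded t_def]
  have last_row: "f a \<le> f s" if "facet ?K1 a b" for a b
    using s(2)[of a] that A I by (auto simp: facet_def)
  have st: "(s, t) \<in> SH ?K1 f"
    using s(1) t A I last_row by (intro lowest_pair_shallow[OF K1]) auto
  note stD = shallow_pairD[OF K1 st]
  have self: "inc ?K1 s s = 0" using facet_less[OF K1, of s s] stD(1) by (auto simp: facet_def)
  have Y: "Y = {y \<in> I - {s, t}. inc ?K1 y s \<noteq> 0}"
  proof -
    have "f t < f y" if "y \<in> I" "y \<noteq> t" "inc ?K1 y s \<noteq> 0" for y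
      using stD(7)[of y] filter_inj[OF K1 stD(2), of y] that I by force
    then show ?thesis using A stD(1) I self unfolding Y_def by auto
  qed
  have step: "death_step f S = (I - {s, t},
         (\<lambda>x y. if y \<in> Y then A x y - inverse (A s t) * A s y * A x t else A x y),
         insert (s, t) D, L \<union> {(t, y) | y. y \<in> Y})"
    unfolding S death_step_def s_def t_def Y_def by (simp add: Let_def)
  have Q: "facet ?K1 a b \<or> facet ?K1 a t" if "facet (quotient ?K1 (s, t)) a b" for a b
    using that stD(2) by (auto simp: facet_def)
  have "f a < f (fst d)" if "facet (quotient ?K1 (s, t)) a b" "d \<in> set (ds @ [(s, t)])" for a b d
  proof (cases "d \<in> set ds")
    case True then show ?thesis using Q[OF that(1)] rows by blast
  next
    case False
    then have [simp]: "d = (s, t)" using that(2) by simp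
    have a: "a \<in> cells ?K1" "a \<noteq> s" using that(1) by (auto simp: facet_def)
    have "f a \<le> f s" using Q[OF that(1)] last_row by blast
    then show ?thesis using filter_inj[OF K1 a(1) stD(1)] a(2) by force
  qed
  moreover have "sorted_wrt (\<lambda>p q. f (fst q) < f (fst p)) (ds @ [(s, t)])"
    using ds(2) rows[of s t] stD by (auto simp: sorted_wrt_append facet_def)
  moreover have "(if y \<in> Y then A x y - inverse (A s t) * A s y * A x t else A x y)
      = inc (quotient ?K1 (s, t)) y x" if "x \<in> I - {s, t}" "y \<in> I - {s, t}" for x y
    using that A stD(1,2) I unfolding Y by auto
  ultimately have "death_invariant K f (ds @ [(s, t)]) (death_step f S)"
    unfolding step death_invariant_def death_links_snoc using ds(1) st I D L Y
    by (auto simp del: quotient_simps(3))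
  then show "\<exists>ds'. death_invariant K f ds' (death_step f S)" by blast
  show "card (fst (death_step f S)) < card (fst S)"
    unfolding step using S I fin stD(1) by (auto intro!: psubset_card_mono)
qed

text \<open>
  Since the births descend along \<open>ds\<close>, the pairs cancelled before \<open>p\<close> are those with a later birth, and the
  column of \<open>q\<close> is still present if and only if \<open>q\<close> has an earlier birth.
\<close>

lemma death_links_eq_death_rel:
  assumes K: "filtered_lefschetz K f" and ds: "shallow_seq K f ds" "set ds = BD K f"
    and sorted: "sorted_wrt (\<lambda>p q. f (fst q) < f (fst p)) ds"
  shows "{(p, q). p \<in> BD K f \<and> q \<in> BD K f \<and> (snd p, snd q) \<in> death_links K ds} = death_rel K f"
proof -
  note dist = shallow_seq_distinct(1)[OF K ds(1)]
  have order: "f (fst (ds ! i)) < f (fst (ds ! j)) \<longleftrightarrow> j < i" if "i < length ds" "j < length ds" for i j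
    using sorted that unfolding sorted_wrt_iff_nth_less by (cases i j rule: linorder_cases) force+
  have before: "set (take i ds) = {r \<in> BD K f. f (fst (ds ! i)) < f (fst r)}" if "i < length ds" for i
  proof -
    have "set (take i ds) = (!) ds ` {0..<i}" "BD K f = (!) ds ` {0..<length ds}"
      using nth_image[of i ds] nth_image[of "length ds" ds] that ds(2) by auto
    then show ?thesis using order[OF that] that by auto
  qed
  have seq: "shallow_seq K f (take i ds)" for i
    using ds(1) shallow_seq_append[of K f "take i ds" "drop i ds"] by simp
  have "(snd p, snd q) \<in> death_links K ds \<longleftrightarrow> (p, q) \<in> death_rel K f"
    if pq: "p \<in> BD K f" "q \<in> BD K f" for p q
  proof -
    obtain i j where i: "p = ds ! i" "i < length ds" and j: "q = ds ! j" "j < length ds"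
      using pq ds(2) by (metis in_set_conv_nth)
    have index: "snd (ds ! i') = snd p \<longleftrightarrow> i' = i" if "i' < length ds" for i'
    proof -
      have "ds ! i' \<in> BD K f" using that ds(2) nth_mem by blast
      then have "snd (ds ! i') = snd p \<longleftrightarrow> ds ! i' = p" using BD_disjoint[OF K _ pq(1)] by blast
      then show ?thesis using i that dist by (simp add: nth_eq_iff_index_eq)
    qed
    have "(snd p, snd q) \<in> death_links K ds \<longleftrightarrow> (\<exists>i'. i' < length ds \<and> snd (ds ! i') = snd p \<and>
      snd q \<in> cells (cancel K (take (Suc i') ds)) \<and>
      inc (cancel K (take i' ds)) (snd q) (fst (ds ! i')) \<noteq> 0)"
      unfolding death_links_def by (simp add: eq_commute[of "snd p"] conj_ac)
    then have links: "(snd p, snd q) \<in> death_links K ds \<longleftrightarrow>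
      snd q \<in> cells (cancel K (take (Suc i) ds)) \<and> inc (cancel K (take i ds)) (snd q) (fst p) \<noteq> 0"
      using index i by metis
    have "set (take (Suc i) ds) = (!) ds ` {0..<Suc i}" using nth_image[of "Suc i" ds] i by simp
    then have mem: "q \<in> set (take (Suc i) ds) \<longleftrightarrow> j \<le> i"
      using i j dist by (auto simp: nth_eq_iff_index_eq image_iff intro!: bexI[of _ j])
    have "snd q \<in> cells (cancel K (take (Suc i) ds)) \<longleftrightarrow> q \<notin> set (take (Suc i) ds)"
      using shallow_seq_uncancelled[OF K ds(1), of q "take (Suc i) ds"] pq(2) ds(2)
        set_take_subset[of "Suc i" ds]
      by (auto simp: cells_cancel)
    also have "q \<notin> set (take (Suc i) ds) \<longleftrightarrow> i < j" using mem by auto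
    also have "i < j \<longleftrightarrow> f (fst q) < f (fst p)" using order[OF j(2) i(2)] i j by simp
    finally have later: "snd q \<in> cells (cancel K (take (Suc i) ds)) \<longleftrightarrow> f (fst q) < f (fst p)" .
    have "(\<exists>us. shallow_seq K f us \<and> set us = {r \<in> BD K f. f (fst p) < f (fst r)} \<and>
           inc (cancel K us) (snd q) (fst p) \<noteq> 0) \<longleftrightarrow> inc (cancel K (take i ds)) (snd q) (fst p) \<noteq> 0"
    proof -
      have stage: "cancel K us = cancel K (take i ds)"
        if "shallow_seq K f us" "set us = {r \<in> BD K f. f (fst p) < f (fst r)}" for us
        by (rule cancel_cong_set[OF K that(1) seq]) (simp only: that(2) before[OF i(2)] i(1))
      moreover have "set (take i ds) = {r \<in> BD K f. f (fst p) < f (fst r)}"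
        by (simp only: before[OF i(2)] i(1))
      ultimately show ?thesis using seq[of i] by (metis (lifting))
    qed
    then show ?thesis unfolding links later death_rel_def using pq by simp
  qed
  then show ?thesis using death_rel_D[of _ _ K f] by fast
qed

lemma DEATH_loop:
  assumes K: "filtered_lefschetz K f"
  shows "\<exists>I A L. while_option nonzero_state (death_step f) (cells K, boundary_matrix K, {}, {})
      = Some (I, A, BD K f, L) \<and>
    {((s, t), (s', t')). (s, t) \<in> BD K f \<and> (s', t') \<in> BD K f \<and> (t, t') \<in> L} = death_rel K f"
proof -
  let ?S0 = "(cells K, boundary_matrix K, {}, {})"
  let ?inv = "\<lambda>S. \<exists>ds. death_invariant K f ds S"
  have init: "?inv ?S0"
    by (intro exI[of _ "[]"]) (simp add: death_invariant_def death_links_def boundary_matrix_def)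
  obtain S where S: "while_option nonzero_state (death_step f) ?S0 = Some S"
    using measure_while_option_Some[of ?inv nonzero_state "death_step f" "\<lambda>S. card (fst S)" ?S0]
      init death_invariant_step[OF K] by blast
  have "?inv S"
    using while_option_rule[of ?inv nonzero_state "death_step f", OF _ S init] death_invariant_step(1)[OF K]
    by blast
  then obtain ds where inv: "death_invariant K f ds S" by blast
  obtain I A D L where S': "S = (I, A, D, L)" by (cases S)
  have ds: "shallow_seq K f ds" "sorted_wrt (\<lambda>p q. f (fst q) < f (fst p)) ds"
    and I: "I = cells (cancel K ds)" "\<And>x y. x \<in> I \<Longrightarrow> y \<in> I \<Longrightarrow> A x y = inc (cancel K ds) y x"
    and D: "D = set ds" and L: "L = death_links K ds"
    using inv by (auto simp: S' death_invariant_def)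
  have "\<not> facet (cancel K ds) x y" for x y
    using while_option_stop[OF S] I by (auto simp: S' nonzero_state_def facet_def)
  then have "set ds = BD K f"
    using BD_cancel[OF K ds(1)] BD_zero[OF filtered_lefschetz_cancel[OF K ds(1)]] by simp
  then show ?thesis
    using S S' D L death_links_eq_death_rel[OF K ds(1) _ ds(2)] by (auto simp: case_prod_beta')
qed

lemma DEATH_correct:
  assumes K: "filtered_lefschetz K f"
  shows "DEATH (cells K) f (boundary_matrix K) = Some (BD K f, death_rel K f)"
  using DEATH_loop[OF K] unfolding DEATH_def by auto

definition transpose_state :: "('a, 'k) state \<Rightarrow> ('a, 'k) state" where
  "transpose_state = (\<lambda>(I, A, D, L). (I, \<lambda>x y. A y x, prod.swap ` D, L))"

lemma transpose_birth_step:
  "transpose_state (birth_step f S) = death_step (\<lambda>x. - f x) (transpose_state S)"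
  by (cases S) (simp add: transpose_state_def birth_step_def death_step_def arg_min_max_on_uminus Let_def insert_commute)

lemma BIRTH_correct:
  assumes K: "filtered_lefschetz K f"
  shows "BIRTH (cells K) f (boundary_matrix K) = Some (BD K f, birth_rel K f)"
proof -
  let ?S0 = "(cells K, boundary_matrix K, {}, {})"
  have nz: "nonzero_state S = nonzero_state (transpose_state S)" for S :: "('a, 'b) state"
    by (cases S) (auto simp: nonzero_state_def transpose_state_def)
  have "map_option transpose_state (while_option nonzero_state (birth_step f) ?S0)
      = while_option nonzero_state (death_step (\<lambda>x. - f x)) (transpose_state ?S0)"
    by (rule while_option_commute) (rule nz, rule transpose_birth_step)
  also have "transpose_state ?S0 = (cells (dual K), boundary_matrix (dual K), {}, {})"
    by (simp add: transpose_state_def boundary_matrix_def fun_eq_iff)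
  finally obtain I A D L where
    run: "while_option nonzero_state (birth_step f) ?S0 = Some (I, A, D, L)"
    and D: "prod.swap ` D = BD (dual K) (\<lambda>x. - f x)"
    and L: "{((s, t), (s', t')). (s, t) \<in> BD (dual K) (\<lambda>x. - f x) \<and> (s', t') \<in> BD (dual K) (\<lambda>x. - f x)
      \<and> (t, t') \<in> L} = death_rel (dual K) (\<lambda>x. - f x)"
    using DEATH_loop[OF filtered_lefschetz_dual[OF K]] by (auto simp: transpose_state_def)
  have D': "D = BD K f"
  proof -
    have "prod.swap ` prod.swap ` D = prod.swap ` prod.swap ` BD K f" using D BD_dual[OF K] by simp
    then show ?thesis by (simp add: image_image)
  qed
  have mem: "(b, a) \<in> BD (dual K) (\<lambda>x. - f x) \<longleftrightarrow> (a, b) \<in> BD K f" for a b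
    unfolding BD_dual[OF K] by force
  have "{((s, t), (s', t')). (s, t) \<in> BD K f \<and> (s', t') \<in> BD K f \<and> (s, s') \<in> L} = birth_rel K f"
    unfolding birth_rel_def L[symmetric] by (auto simp: mem)
  then show ?thesis unfolding BIRTH_def run D' by simp
qed

theorem theorem8p4:
  fixes K :: "('a, 'k::field) lefschetz" and f :: "'a \<Rightarrow> real"
  assumes "lefschetz_complex K" and "filter_on K f"
  shows "DEPTH_POSET (cells K) f (boundary_matrix K) = Some (depth_poset K f)"
proof -
  have K: "filtered_lefschetz K f" using assms by (simp add: filtered_lefschetz_def)
  show ?thesis
    unfolding DEPTH_POSET_def DEATH_correct[OF K] BIRTH_correct[OF K] depth_poset_eq_closure[OF K]
    by simp
qed

end
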